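(* Let $U$ be a $C^\infty$ potential on $\mathbb{R}^n$ such that $\mu(dx)=\frac1{Z_U}e^{-U(x)}dx$ is a probability measure, and assume that for some $K>0$ and $\beta\ge1$, $$\langle\nabla U(x)-\nabla U(y),x-y\rangle\ge K|x-y|^{2\beta}\quad\text{for all }x,y.$$ Then $\mu$ satisfies a Poincaré inequality with constant $$C_P(\mu)\le 4\,(36)^{\frac{2\beta-1}{\beta}}\Big(\frac{32}{K^2}\Big)^{\frac1{2\beta}},$$ and a log-Sobolev inequality with constant $$C_{LS}(\mu)\le\Big(\frac{32}{K^2}\Big)^{\frac1{2\beta}}\Big(4^{\frac{3\beta-2}{2\beta-1}}36^{\frac{\beta-1}\beta}+8\times36^{\frac{2\beta-1}\beta}\Big).$$
   Context: Poincaré inequality with constant $C_P$: $\mathrm{Var}_\mu(f)\le C_P\int|\nabla f|^2d\mu$. Log-Sobolev inequality with constant $C_{LS}$: $\int f^2\log f^2d\mu-\int f^2d\mu\log\int f^2d\mu\le C_{LS}\int|\nabla f|^2d\mu$. *)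

theory Defs
  imports "HOL-Analysis.Analysis"
begin

text \<open>Partial derivative of a real-valued function on a Euclidean space in the
  direction of a basis vector i (as a pointwise derivative; only meaningful where it exists).\<close>
definition partial_deriv :: "'a::euclidean_space \<Rightarrow> ('a \<Rightarrow> real) \<Rightarrow> 'a \<Rightarrow> real" where
  "partial_deriv i g x = deriv (\<lambda>t. g (x + t *\<^sub>R i)) 0"

definition iter_partial :: "'a::euclidean_space list \<Rightarrow> ('a \<Rightarrow> real) \<Rightarrow> 'a \<Rightarrow> real" where
  "iter_partial is g = foldr partial_deriv is g"

definition smooth_fun :: "('a::euclidean_space \<Rightarrow> real) \<Rightarrow> bool" where
  "smooth_fun g \<longleftrightarrow>
     (\<forall>is. set is \<subseteq> Basis \<longrightarrow>
        continuous_on UNIV (iter_partial is g) \<and>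
        (\<forall>i\<in>Basis. \<forall>x. (\<lambda>t. iter_partial is g (x + t *\<^sub>R i)) differentiable (at 0)))"

definition gibbs :: "('a::euclidean_space \<Rightarrow> real) \<Rightarrow> 'a measure" where
  "gibbs U = density lborel (\<lambda>x. ennreal (exp (- U x) / (\<integral>y. exp (- U y) \<partial>lborel)))"

end

theory Submission
  imports Defs "HOL-Probability.Distribution_Functions"
begin

text \<open>
  Monotonicity of the gradient gives
  \<open>U y \<ge> U x + \<langle>\<nabla>U x, y - x\<rangle> + K / (2\<beta>) |y - x|\<^bsup>2\<beta>\<^esup>\<close>, and the power is bounded below by
  \<open>\<kappa>/2 |y - x|\<^sup>2 - 1/2\<close> with \<open>\<kappa> = K\<^bsup>1/\<beta>\<^esup>\<close>. Following Bobkov and Ledoux, the Prekopa-Leindler inequality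
  applied to \<open>e\<^bsup>(1+\<sigma>)G - U\<^esup>\<close> and \<open>e\<^bsup>-U\<^esup>\<close> with weights \<open>1/(1+\<sigma>)\<close>, \<open>\<sigma>/(1+\<sigma>)\<close>, expanded to first order
  in \<open>\<sigma>\<close>, yields the defective log-Sobolev inequality
  \<open>Ent(f\<^sup>2) \<le> 4/\<kappa> \<integral>|\<nabla>f|\<^sup>2 + 1/2 \<integral>f\<^sup>2\<close>. A function supported on a set of mass at most \<open>1/2\<close> has
  \<open>Ent(f\<^sup>2) \<ge> ln 2 \<integral>f\<^sup>2\<close>; since \<open>1/2 < ln 2\<close>, applying the inequality to the parts of \<open>f\<close> above and below
  its median gives a Poincare inequality with constant \<open>96/\<kappa>\<close>. Finally Rothaus' inequality
  \<open>Ent(f\<^sup>2) \<le> Ent((f - m)\<^sup>2) + 10 Var(f)\<close>, \<open>m\<close> being the mean of \<open>f\<close>, removes the defect. The constants so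
  obtained are smaller than the claimed ones, which are at least \<open>720/\<kappa>\<close> and \<open>1440/\<kappa>\<close>.
\<close>

section \<open>The Prekopa-Leindler inequality\<close>

text \<open>Prekopa-Leindler makes exactly such comparisons. Trading the power for a quadratic by
  Young's inequality costs at most 1/2, uniformly in \<beta>, and this loss reappears unchanged as
  the defect. The entropy enters because, for a function G whose exponential has integral 1, it is
  the derivative at \<sigma> = 0 of
  \<open>ln (\<integral> exp ((1 + \<sigma>) G)) / (1 + \<sigma>)\<close>, the logarithm of the left
  side of Prekopa-Leindler. The expansion in \<sigma> needs G and its gradient bounded and the
  gradient uniformly continuous. So it is carried out for
  \<open>G = ln (u\<^sup>2 + \<epsilon>\<^sup>2)\<close> with u of compact support. Cutoffs then
  reach general f, and Fatou's lemma supplies the integrability of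
  \<open>f\<^sup>2 ln f\<^sup>2\<close>, which is a conclusion and not an assumption.\<close>

lemma real_set_cofinal_sequence:
  fixes A :: "real set"
  assumes "A \<noteq> {}"
  obtains a :: "nat \<Rightarrow> real" where "incseq a" "range a \<subseteq> A" "\<And>x. x \<in> A \<Longrightarrow> \<exists>n. x \<le> a n"
proof (cases "\<exists>m\<in>A. \<forall>x\<in>A. x \<le> m")
  case True
  then obtain m where "m \<in> A" "\<forall>x\<in>A. x \<le> m" by blast
  then show ?thesis by (intro that[of "\<lambda>_. m"]) (auto simp: incseq_def)
next
  case False
  \<comment> \<open>Taking the supremum in \<open>ereal\<close> treats sets unbounded above like the
    rest. Without a maximum every element lies strictly below the supremum, so the approximating
    sequence passes it.\<close>
  from assms have "ereal ` A \<noteq> {}" by simp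
  from Sup_countable_SUP[OF this] obtain f :: "nat \<Rightarrow> ereal"
    where f: "incseq f" "range f \<subseteq> ereal ` A" "Sup (ereal ` A) = (SUP i. f i)" by blast
  define a where "a n = real_of_ereal (f n)" for n
  have fa: "f n = ereal (a n)" and aA: "a n \<in> A" for n
  proof -
    have "f n \<in> ereal ` A" using f(2) by blast
    then show "f n = ereal (a n)" "a n \<in> A" by (auto simp: a_def)
  qed
  show ?thesis
  proof (rule that[of a])
    show "incseq a" using f(1) by (simp add: fa incseq_def)
    show "range a \<subseteq> A" using aA by auto
    fix x assume "x \<in> A"
    with False obtain y where "y \<in> A" "x < y" by (meson not_le)
    then have "ereal x < (SUP i. f i)"
      unfolding f(3)[symmetric] by (meson SUP_upper ereal_less_eq(3) image_eqI less_SUP_iff less_ereal.simps(1))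
    then obtain n where "ereal x < f n" by (auto simp: less_SUP_iff)
    then show "\<exists>n. x \<le> a n" by (auto simp: fa intro: exI[of _ n])
  qed
qed

text \<open>C contains a translate of t A lying left of \<open>m = t * a + s * b\<close> and a
  translate of s B lying right of it. They overlap at most in the point m, so their lengths add
  up.\<close>

lemma brunn_minkowski_real_aux:
  fixes A B C :: "real set"
  assumes [measurable]: "A \<in> sets borel" "B \<in> sets borel" "C \<in> sets borel"
    and ts: "t > 0" "s > 0" and ab: "a \<in> A" "b \<in> B"
    and sub: "\<And>x y. x \<in> A \<Longrightarrow> y \<in> B \<Longrightarrow> t * x + s * y \<in> C"
  shows "ennreal t * emeasure lborel (A \<inter> {..a}) + ennreal s * emeasure lborel (B \<inter> {b..})
           \<le> emeasure lborel C"
proof -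
  define m where "m = t * a + s * b"
  have "ennreal t * emeasure lborel (A \<inter> {..a})
      = ennreal t * (\<integral>\<^sup>+x. indicator (A \<inter> {..a}) x \<partial>lborel)" by simp
  also have "\<dots> \<le> ennreal t * (\<integral>\<^sup>+x. indicator (C \<inter> {..m}) (s * b + t * x) \<partial>lborel)"
    using sub ab ts by (intro mult_left_mono nn_integral_mono)
      (auto simp: indicator_def m_def add.commute mult_left_mono)
  also have "\<dots> = emeasure lborel (C \<inter> {..m})"
    using nn_integral_real_affine[of "indicator (C \<inter> {..m})" t "s * b"] ts by simp
  finally have 1: "ennreal t * emeasure lborel (A \<inter> {..a}) \<le> emeasure lborel (C \<inter> {..m})" .
  \<comment> \<open>Discarding the null set \<open>{b}\<close> makes the right-hand piece avoid m,
    so that the two pieces of C are disjoint.\<close>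
  have "emeasure lborel (B \<inter> {b..}) = emeasure lborel (B \<inter> {b<..})"
    using AE_lborel_singleton[of b] by (intro emeasure_eq_AE) auto
  then have "ennreal s * emeasure lborel (B \<inter> {b..})
      = ennreal s * (\<integral>\<^sup>+x. indicator (B \<inter> {b<..}) x \<partial>lborel)" by simp
  also have "\<dots> \<le> ennreal s * (\<integral>\<^sup>+x. indicator (C \<inter> {m<..}) (t * a + s * x) \<partial>lborel)"
    using sub ab ts by (intro mult_left_mono nn_integral_mono)
      (auto simp: indicator_def m_def)
  also have "\<dots> = emeasure lborel (C \<inter> {m<..})"
    using nn_integral_real_affine[of "indicator (C \<inter> {m<..})" s "t * a"] ts by simp
  finally have 2: "ennreal s * emeasure lborel (B \<inter> {b..}) \<le> emeasure lborel (C \<inter> {m<..})" .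
  have "emeasure lborel (C \<inter> {..m}) + emeasure lborel (C \<inter> {m<..})
      = emeasure lborel ((C \<inter> {..m}) \<union> (C \<inter> {m<..}))"
    by (rule plus_emeasure) auto
  also have "(C \<inter> {..m}) \<union> (C \<inter> {m<..}) = C" by auto
  finally show ?thesis using add_mono[OF 1 2] by simp
qed

text \<open>A need not have a largest element nor B a smallest one, so the cut points run through a
  cofinal sequence of A and a coinitial one of B, and the truncated sets exhaust A and B.
  Nonemptiness is essential: with B empty, C could be empty too.\<close>

lemma brunn_minkowski_real:
  fixes A B C :: "real set"
  assumes meas[measurable]: "A \<in> sets borel" "B \<in> sets borel" "C \<in> sets borel"
    and ts: "t > 0" "s > 0" and ne: "A \<noteq> {}" "B \<noteq> {}"
    and sub: "\<And>x y. x \<in> A \<Longrightarrow> y \<in> B \<Longrightarrow> t * x + s * y \<in> C"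
  shows "ennreal t * emeasure lborel A + ennreal s * emeasure lborel B \<le> emeasure lborel C"
proof -
  obtain a where a: "incseq a" "range a \<subseteq> A" "\<And>x. x \<in> A \<Longrightarrow> \<exists>n. x \<le> a n"
    using real_set_cofinal_sequence[OF ne(1)] by metis
  obtain b' where b': "incseq b'" "range b' \<subseteq> uminus ` B" "\<And>x. x \<in> uminus ` B \<Longrightarrow> \<exists>n. x \<le> b' n"
    using real_set_cofinal_sequence[of "uminus ` B"] ne(2) by auto
  have b'_B: "- b' n \<in> B" for n
  proof -
    have "b' n \<in> uminus ` B" using b'(2) by blast
    then show ?thesis by auto
  qed
  have Alim: "(\<lambda>n. emeasure lborel (A \<inter> {..a n})) \<longlonglongrightarrow> emeasure lborel (\<Union>n. A \<inter> {..a n})"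
    using a(1) by (intro Lim_emeasure_incseq) (auto simp: incseq_def intro: order_trans)
  have Aeq: "(\<Union>n. A \<inter> {..a n}) = A" using a(3) by auto
  have Blim: "(\<lambda>n. emeasure lborel (B \<inter> {- b' n..})) \<longlonglongrightarrow> emeasure lborel (\<Union>n. B \<inter> {- b' n..})"
    using b'(1) by (intro Lim_emeasure_incseq) (force simp: incseq_def intro: order_trans)+
  have Beq: "(\<Union>n. B \<inter> {- b' n..}) = B"
  proof -
    have "\<exists>n. - b' n \<le> y" if "y \<in> B" for y
      using b'(3)[of "- y"] that by (auto simp: minus_le_iff)
    then show ?thesis by auto
  qed
  have "(\<lambda>n. ennreal t * emeasure lborel (A \<inter> {..a n}) + ennreal s * emeasure lborel (B \<inter> {- b' n..}))
     \<longlonglongrightarrow> ennreal t * emeasure lborel A + ennreal s * emeasure lborel B"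
    using Alim Blim unfolding Aeq Beq by (intro tendsto_add ennreal_tendsto_cmult) auto
  moreover have "ennreal t * emeasure lborel (A \<inter> {..a n}) + ennreal s * emeasure lborel (B \<inter> {- b' n..})
      \<le> emeasure lborel C" for n
    using a(2) b'_B sub ts by (intro brunn_minkowski_real_aux) auto
  ultimately show ?thesis using LIMSEQ_le_const2 by blast
qed

section \<open>Prekopa-Leindler in dimension one\<close>

text \<open>Encodes \<open>u\<^sup>t v\<^sup>s \<le> w\<close> for extended values, with the convention \<open>0 \<cdot> \<infinity> = 0\<close>.\<close>
definition geo_mean_le :: "real \<Rightarrow> real \<Rightarrow> ennreal \<Rightarrow> ennreal \<Rightarrow> ennreal \<Rightarrow> bool" where
  "geo_mean_le t s u v w \<longleftrightarrow>
     (\<forall>a>0. \<forall>b>0. ennreal a \<le> u \<longrightarrow> ennreal b \<le> v \<longrightarrow> ennreal (a powr t * b powr s) \<le> w)"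

lemma geo_mean_leD:
  "geo_mean_le t s u v w \<Longrightarrow> a > 0 \<Longrightarrow> b > 0 \<Longrightarrow> ennreal a \<le> u \<Longrightarrow> ennreal b \<le> v
     \<Longrightarrow> ennreal (a powr t * b powr s) \<le> w"
  by (auto simp: geo_mean_le_def)

text \<open>Levels are measured relative to the bound c. Functions with different bounds can then be
  compared at the same relative level r in (0, 1), which is how Brunn-Minkowski is applied
  below.\<close>

lemma nn_integral_layer_cake_bounded:
  fixes f :: "'b \<Rightarrow> ennreal"
  assumes "sigma_finite_measure M" and [measurable]: "f \<in> borel_measurable M"
    and c: "c > 0" and bd: "\<And>x. f x \<le> ennreal c"
  shows "(\<integral>\<^sup>+x. f x \<partial>M)
    = ennreal c * (\<integral>\<^sup>+r. indicator {0<..<1} r * emeasure M {x \<in> space M. ennreal (c * r) < f x} \<partial>lborel)"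
proof -
  interpret pair_sigma_finite M "lborel :: real measure"
    using assms(1) by (simp add: pair_sigma_finite_def sigma_finite_lborel)
  have fx: "f x = ennreal c * (\<integral>\<^sup>+r. indicator {r. 0 < r \<and> r < 1 \<and> ennreal (c * r) < f x} r \<partial>lborel)" for x
  proof -
    obtain y where y: "f x = ennreal y" "0 \<le> y" "y \<le> c"
      using bd[of x] c by (cases "f x") (auto simp: top_unique)
    have "{r. 0 < r \<and> r < 1 \<and> ennreal (c * r) < f x} = {0<..<y / c}"
    proof -
      have "r < 1" if "r * c < y" for r
      proof -
        have "r * c < 1 * c" using that y by simp
        then show ?thesis using c by (simp only: mult_less_cancel_right_pos)
      qed
      then show ?thesis using c y by (auto simp: ennreal_less_iff field_simps)
    qed
    then show ?thesis using c y by (simp add: ennreal_mult[symmetric])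
  qed
  have "(\<integral>\<^sup>+x. f x \<partial>M) = ennreal c * (\<integral>\<^sup>+x. (\<integral>\<^sup>+r. indicator {r. 0 < r \<and> r < 1 \<and> ennreal (c * r) < f x} r \<partial>lborel) \<partial>M)"
    by (subst fx) (simp add: nn_integral_cmult)
  also have "(\<integral>\<^sup>+x. (\<integral>\<^sup>+r. indicator {r. 0 < r \<and> r < 1 \<and> ennreal (c * r) < f x} r \<partial>lborel) \<partial>M)
      = (\<integral>\<^sup>+r. (\<integral>\<^sup>+x. indicator {r. 0 < r \<and> r < 1 \<and> ennreal (c * r) < f x} r \<partial>M) \<partial>lborel)"
    by (rule Fubini'[symmetric]) measurable
  also have "\<dots> = (\<integral>\<^sup>+r. indicator {0<..<1} r * emeasure M {x \<in> space M. ennreal (c * r) < f x} \<partial>lborel)"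
  proof (rule nn_integral_cong)
    fix r :: real
    have "(\<integral>\<^sup>+x. indicator {r. 0 < r \<and> r < 1 \<and> ennreal (c * r) < f x} r \<partial>M)
      = (\<integral>\<^sup>+x. indicator {0<..<1} r * indicator {x \<in> space M. ennreal (c * r) < f x} x \<partial>M)"
      by (intro nn_integral_cong) (auto simp: indicator_def)
    also have "\<dots> = indicator {0<..<1} r * emeasure M {x \<in> space M. ennreal (c * r) < f x}"
      by (subst nn_integral_cmult) auto
    finally show "(\<integral>\<^sup>+x. indicator {r. 0 < r \<and> r < 1 \<and> ennreal (c * r) < f x} r \<partial>M)
      = indicator {0<..<1} r * emeasure M {x \<in> space M. ennreal (c * r) < f x}" .
  qed
  finally show ?thesis .
qed

text \<open>After division by their suprema A and B, f and g have nonempty level sets at every r <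
  1. Brunn-Minkowski bounds the level set of h at \<open>A powr t * B powr s * r\<close> from below;
  integration over r gives a weighted sum, which dominates the geometric mean.\<close>

lemma prekopa_leindler_real_bounded:
  fixes f g h :: "real \<Rightarrow> ennreal"
  assumes [measurable]: "f \<in> borel_measurable borel" "g \<in> borel_measurable borel" "h \<in> borel_measurable borel"
    and ts: "t > 0" "s > 0" "t + s = 1"
    and bd: "\<And>x. f x \<le> ennreal c" "\<And>x. g x \<le> ennreal c"
    and gm: "\<And>x y. geo_mean_le t s (f x) (g y) (h (t * x + s * y))"
  shows "geo_mean_le t s (\<integral>\<^sup>+x. f x \<partial>lborel) (\<integral>\<^sup>+x. g x \<partial>lborel) (\<integral>\<^sup>+x. h x \<partial>lborel)"
proof -
  \<comment> \<open>A is the exact supremum, not just a bound: the level sets must be nonempty for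
    all r < 1 before Brunn-Minkowski can be used. A positive integral forces A > 0.\<close>
  have sup: "\<exists>A>0. (\<forall>x. u x \<le> ennreal A) \<and> (\<forall>r. 0 < r \<longrightarrow> r < 1 \<longrightarrow> (\<exists>x. ennreal (A * r) < u x))"
    if "\<And>x. u x \<le> ennreal c" "0 < a" "ennreal a \<le> (\<integral>\<^sup>+x. u x \<partial>lborel)"
    for u :: "real \<Rightarrow> ennreal" and a
  proof -
    have "(SUP x. u x) \<le> ennreal c" using that(1) by (rule SUP_least)
    then obtain A where A: "(SUP x. u x) = ennreal A" "0 \<le> A"
      by (cases "SUP x. u x") (auto simp: top_unique)
    have le: "u x \<le> ennreal A" for x using A by (metis SUP_upper UNIV_I)
    have "A \<noteq> 0"
    proof
      assume "A = 0"
      then have "(\<integral>\<^sup>+x. u x \<partial>lborel) = 0" using le by simp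
      with that show False by simp
    qed
    with A have "A > 0" by simp
    moreover have "\<exists>x. ennreal (A * r) < u x" if "0 < r" "r < 1" for r
    proof -
      have "ennreal (A * r) < (SUP x. u x)" using A \<open>A > 0\<close> that by (simp add: ennreal_less_iff)
      then show ?thesis by (auto simp: less_SUP_iff)
    qed
    ultimately show ?thesis using le by blast
  qed
  show ?thesis unfolding geo_mean_le_def
  proof (intro allI impI)
    fix a b :: real
    assume ab: "a > 0" "b > 0" "ennreal a \<le> (\<integral>\<^sup>+x. f x \<partial>lborel)" "ennreal b \<le> (\<integral>\<^sup>+x. g x \<partial>lborel)"
    obtain A where A: "A > 0" "\<And>x. f x \<le> ennreal A" "\<And>r. 0 < r \<Longrightarrow> r < 1 \<Longrightarrow> \<exists>x. ennreal (A * r) < f x"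
      using sup[OF bd(1) ab(1,3)] by blast
    obtain B where B: "B > 0" "\<And>x. g x \<le> ennreal B" "\<And>r. 0 < r \<Longrightarrow> r < 1 \<Longrightarrow> \<exists>x. ennreal (B * r) < g x"
      using sup[OF bd(2) ab(2,4)] by blast
    define C where "C = A powr t * B powr s"
    have C: "C > 0" using A B by (simp add: C_def)
    \<comment> \<open>Capping h at C makes the layer cake formula applicable and does not change the
      level sets below C.\<close>
    define h' where "h' x = min (h x) (ennreal C)" for x
    have [measurable]: "h' \<in> borel_measurable borel" unfolding h'_def by measurable
    define If where "If = (\<integral>\<^sup>+r. indicator {0<..<1} r * emeasure lborel {x. ennreal (A * r) < f x} \<partial>lborel)"
    define Ig where "Ig = (\<integral>\<^sup>+r. indicator {0<..<1} r * emeasure lborel {x. ennreal (B * r) < g x} \<partial>lborel)"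
    have f_eq: "(\<integral>\<^sup>+x. f x \<partial>lborel) = ennreal A * If"
      using nn_integral_layer_cake_bounded[OF sigma_finite_lborel, of f A] A by (simp add: If_def)
    have g_eq: "(\<integral>\<^sup>+x. g x \<partial>lborel) = ennreal B * Ig"
      using nn_integral_layer_cake_bounded[OF sigma_finite_lborel, of g B] B by (simp add: Ig_def)
    have lev: "ennreal t * emeasure lborel {x. ennreal (A * r) < f x} + ennreal s * emeasure lborel {x. ennreal (B * r) < g x}
        \<le> emeasure lborel {x. ennreal (C * r) < h' x}" if r: "0 < r" "r < 1" for r
    proof (rule brunn_minkowski_real)
      fix x y assume "x \<in> {x. ennreal (A * r) < f x}" "y \<in> {x. ennreal (B * r) < g x}"
      then have xy: "ennreal (A * r) < f x" "ennreal (B * r) < g y" by auto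
      obtain a' where a': "f x = ennreal a'" "0 \<le> a'" using A(2)[of x] by (cases "f x") (auto simp: top_unique)
      obtain b' where b': "g y = ennreal b'" "0 \<le> b'" using B(2)[of y] by (cases "g y") (auto simp: top_unique)
      have lt: "A * r < a'" "B * r < b'" using xy a' b' A(1) B(1) r by (auto simp: ennreal_less_iff)
      have pos: "0 < A * r" "0 < B * r" using A(1) B(1) r by auto
      have "C * r = C * r powr (t + s)" using ts r by simp
      also have "\<dots> = (A * r) powr t * (B * r) powr s"
        using A(1) B(1) r unfolding C_def powr_add by (simp add: powr_mult)
      also have "\<dots> < a' powr t * b' powr s"
        using lt pos ts by (intro mult_strict_mono powr_less_mono2) auto
      finally have "ennreal (C * r) < ennreal (a' powr t * b' powr s)"
        using C r by (simp add: ennreal_less_iff)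
      also have "\<dots> \<le> h (t * x + s * y)"
        using a' b' lt pos by (intro geo_mean_leD[OF gm[of x y]]) auto
      finally have "ennreal (C * r) < h (t * x + s * y)" .
      moreover have "ennreal (C * r) < ennreal C" using C r by (simp add: ennreal_less_iff)
      ultimately show "t * x + s * y \<in> {x. ennreal (C * r) < h' x}" by (simp add: h'_def)
    qed (use ts A(3)[OF r] B(3)[OF r] in auto)
    have aA: "ennreal (a / A) \<le> If"
    proof -
      have "ennreal (a / A) * ennreal A \<le> If * ennreal A"
        using ab A f_eq by (simp add: ennreal_mult[symmetric] mult.commute)
      then show ?thesis using A(1) by (simp add: ennreal_mult_le_mult_iff mult.commute[of _ "ennreal A"])
    qed
    have bB: "ennreal (b / B) \<le> Ig"
    proof -
      have "ennreal (b / B) * ennreal B \<le> Ig * ennreal B"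
        using ab B g_eq by (simp add: ennreal_mult[symmetric] mult.commute)
      then show ?thesis using B(1) by (simp add: ennreal_mult_le_mult_iff mult.commute[of _ "ennreal B"])
    qed
    \<comment> \<open>The weighted arithmetic-geometric mean inequality is applied to the normalised
      quantities \<open>a / A\<close> and \<open>b / B\<close>, whose weighted sum is what the level
      sets control.\<close>
    have "a powr t * b powr s = C * ((a / A) powr t * (b / B) powr s)"
      using A B ab by (simp add: C_def powr_divide)
    also have "\<dots> \<le> C * (t * (a / A) + s * (b / B))"
      using Youngs_inequality_0[of t s "a / A" "b / B"] ts A B ab C by (intro mult_left_mono) auto
    finally have "ennreal (a powr t * b powr s) \<le> ennreal C * (ennreal t * ennreal (a / A) + ennreal s * ennreal (b / B))"
      using C ts A B ab by (simp add: ennreal_mult[symmetric] ennreal_plus[symmetric] del: ennreal_plus)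
    also have "\<dots> \<le> ennreal C * (ennreal t * If + ennreal s * Ig)"
      using aA bB by (intro mult_left_mono add_mono) auto
    also have "ennreal t * If + ennreal s * Ig
        = (\<integral>\<^sup>+r. indicator {0<..<1} r * (ennreal t * emeasure lborel {x. ennreal (A * r) < f x}
             + ennreal s * emeasure lborel {x. ennreal (B * r) < g x}) \<partial>lborel)"
      unfolding If_def Ig_def
      by (subst (1 2) nn_integral_cmult[symmetric], measurable)
         (subst nn_integral_add[symmetric], measurable, auto intro!: nn_integral_cong simp: algebra_simps)
    also have "\<dots> \<le> (\<integral>\<^sup>+r. indicator {0<..<1} r * emeasure lborel {x. ennreal (C * r) < h' x} \<partial>lborel)"
      using lev by (intro nn_integral_mono) (auto simp: indicator_def)
    finally have "ennreal (a powr t * b powr s)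
        \<le> ennreal C * (\<integral>\<^sup>+r. indicator {0<..<1} r * emeasure lborel {x. ennreal (C * r) < h' x} \<partial>lborel)"
      by (simp add: mult_left_mono)
    also have "\<dots> = (\<integral>\<^sup>+x. h' x \<partial>lborel)"
      using nn_integral_layer_cake_bounded[OF sigma_finite_lborel, of h' C] C by (simp add: h'_def)
    also have "\<dots> \<le> (\<integral>\<^sup>+x. h x \<partial>lborel)"
      by (intro nn_integral_mono) (simp add: h'_def)
    finally show "ennreal (a powr t * b powr s) \<le> (\<integral>\<^sup>+x. h x \<partial>lborel)" .
  qed
qed

lemma nn_integral_truncate_approx:
  fixes f :: "'b \<Rightarrow> ennreal"
  assumes [measurable]: "f \<in> borel_measurable M" and "z < (\<integral>\<^sup>+x. f x \<partial>M)"
  shows "\<exists>n::nat. z < (\<integral>\<^sup>+x. min (f x) (of_nat n) \<partial>M)"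
proof -
  have "(\<integral>\<^sup>+x. f x \<partial>M) = (\<integral>\<^sup>+x. (SUP n::nat. min (f x) (of_nat n)) \<partial>M)"
    using inf_SUP[of _ "\<lambda>n. of_nat n :: ennreal" UNIV]
    by (intro nn_integral_cong) (simp add: ennreal_SUP_of_nat_eq_top flip: inf_min)
  also have "\<dots> = (SUP n::nat. \<integral>\<^sup>+x. min (f x) (of_nat n) \<partial>M)"
    by (rule nn_integral_monotone_convergence_SUP)
       (auto simp: incseq_def le_fun_def min_le_iff_disj intro!: min.coboundedI2)
  finally show ?thesis using assms(2) by (auto simp: less_SUP_iff)
qed

lemma prekopa_leindler_real:
  fixes f g h :: "real \<Rightarrow> ennreal"
  assumes [measurable]: "f \<in> borel_measurable borel" "g \<in> borel_measurable borel" "h \<in> borel_measurable borel"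
    and ts: "t > 0" "s > 0" "t + s = 1"
    and gm: "\<And>x y. geo_mean_le t s (f x) (g y) (h (t * x + s * y))"
  shows "geo_mean_le t s (\<integral>\<^sup>+x. f x \<partial>lborel) (\<integral>\<^sup>+x. g x \<partial>lborel) (\<integral>\<^sup>+x. h x \<partial>lborel)"
  unfolding geo_mean_le_def
proof (intro allI impI)
  fix a b :: real
  assume ab: "a > 0" "b > 0" "ennreal a \<le> (\<integral>\<^sup>+x. f x \<partial>lborel)" "ennreal b \<le> (\<integral>\<^sup>+x. g x \<partial>lborel)"
  \<comment> \<open>Shrinking by r < 1 makes both bounds strict, so they survive truncation even
    when the integrals are infinite. Since \<open>t + s = 1\<close>, the two shrinking factors
    combine to a single r, which then tends to 1.\<close>
  have main: "ennreal (r * (a powr t * b powr s)) \<le> (\<integral>\<^sup>+x. h x \<partial>lborel)" if r: "0 < r" "r < 1" for r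
  proof -
    have "ennreal (r * a) < ennreal a" "ennreal (r * b) < ennreal b"
      using r ab by (auto simp: ennreal_less_iff)
    with ab have *: "ennreal (r * a) < (\<integral>\<^sup>+x. f x \<partial>lborel)" "ennreal (r * b) < (\<integral>\<^sup>+x. g x \<partial>lborel)"
      by (auto intro: less_le_trans)
    obtain m n :: nat where mn: "ennreal (r * a) < (\<integral>\<^sup>+x. min (f x) (of_nat m) \<partial>lborel)"
        "ennreal (r * b) < (\<integral>\<^sup>+x. min (g x) (of_nat n) \<partial>lborel)"
      using nn_integral_truncate_approx[OF _ *(1)] nn_integral_truncate_approx[OF _ *(2)] by auto
    have "ennreal ((r * a) powr t * (r * b) powr s) \<le> (\<integral>\<^sup>+x. h x \<partial>lborel)"
    proof (rule geo_mean_leD[OF prekopa_leindler_real_bounded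
          [where f="\<lambda>x. min (f x) (of_nat m)" and g="\<lambda>x. min (g x) (of_nat n)" and c="real (max m n)"]])
      show "min (f x) (of_nat m) \<le> ennreal (real (max m n))" for x
        by (rule order_trans[OF min.cobounded2]) (simp add: ennreal_of_nat_eq_real_of_nat ennreal_leI)
      show "min (g x) (of_nat n) \<le> ennreal (real (max m n))" for x
        by (rule order_trans[OF min.cobounded2]) (simp add: ennreal_of_nat_eq_real_of_nat ennreal_leI)
      show "geo_mean_le t s (min (f x) (of_nat m)) (min (g y) (of_nat n)) (h (t * x + s * y))" for x y
        using gm[of x y] by (auto simp: geo_mean_le_def)
    qed (use ts r ab mn in auto)
    moreover have "(r * a) powr t * (r * b) powr s = r powr (t + s) * (a powr t * b powr s)"
      using r ab by (simp add: powr_mult powr_add)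
    ultimately show ?thesis using ts r by simp
  qed
  have "(\<lambda>n. ennreal ((1 - inverse (real (Suc (Suc n)))) * (a powr t * b powr s))) \<longlonglongrightarrow> ennreal ((1 - 0) * (a powr t * b powr s))"
    by (intro tendsto_ennrealI tendsto_intros LIMSEQ_Suc[OF LIMSEQ_inverse_real_of_nat])
  moreover have "ennreal ((1 - inverse (real (Suc (Suc n)))) * (a powr t * b powr s)) \<le> (\<integral>\<^sup>+x. h x \<partial>lborel)" for n
    by (rule main) (auto simp: field_simps)
  ultimately have "ennreal ((1 - 0) * (a powr t * b powr s)) \<le> (\<integral>\<^sup>+x. h x \<partial>lborel)"
    using LIMSEQ_le_const2 by blast
  then show "ennreal (a powr t * b powr s) \<le> (\<integral>\<^sup>+x. h x \<partial>lborel)" by simp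
qed

text \<open>Tensorisation: by the one-dimensional case in the new coordinate, the partial integrals
  of f, g, h again satisfy the hypothesis in the remaining coordinates. These partial integrals may
  be infinite, which is why the hypothesis is phrased for extended values.\<close>

lemma prekopa_leindler_PiM:
  fixes f g h :: "('i \<Rightarrow> real) \<Rightarrow> ennreal"
  assumes ts: "t > 0" "s > 0" "t + s = 1" and "finite I"
    and "f \<in> borel_measurable (PiM I (\<lambda>_. lborel))" "g \<in> borel_measurable (PiM I (\<lambda>_. lborel))"
        "h \<in> borel_measurable (PiM I (\<lambda>_. lborel))"
    and "\<And>x y. x \<in> space (PiM I (\<lambda>_. lborel)) \<Longrightarrow> y \<in> space (PiM I (\<lambda>_. lborel))
           \<Longrightarrow> geo_mean_le t s (f x) (g y) (h (\<lambda>i\<in>I. t * x i + s * y i))"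
  shows "geo_mean_le t s (\<integral>\<^sup>+x. f x \<partial>PiM I (\<lambda>_. lborel)) (\<integral>\<^sup>+x. g x \<partial>PiM I (\<lambda>_. lborel))
           (\<integral>\<^sup>+x. h x \<partial>PiM I (\<lambda>_. lborel))"
  using assms(4-)
proof (induction I arbitrary: f g h rule: finite_induct)
  case empty
  interpret product_sigma_finite "\<lambda>_::'i. lborel :: real measure"
    by (simp add: product_sigma_finite_def sigma_finite_lborel)
  show ?case using empty(4)[of "\<lambda>_. undefined" "\<lambda>_. undefined"]
    by (simp add: nn_integral_empty space_PiM restrict_def)
next
  case (insert i I)
  interpret product_sigma_finite "\<lambda>_::'i. lborel :: real measure"
    by (simp add: product_sigma_finite_def sigma_finite_lborel)
  note [measurable] = insert.prems(1-3)
  have upd: "x(i := a) \<in> space (PiM (insert i I) (\<lambda>_. lborel))" if "x \<in> space (PiM I (\<lambda>_. lborel))" for x and a :: real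
    using that by (auto simp: space_PiM PiE_def extensional_def)
  have "geo_mean_le t s (\<integral>\<^sup>+x. (\<integral>\<^sup>+a. f (x(i := a)) \<partial>lborel) \<partial>PiM I (\<lambda>_. lborel))
     (\<integral>\<^sup>+x. (\<integral>\<^sup>+a. g (x(i := a)) \<partial>lborel) \<partial>PiM I (\<lambda>_. lborel))
     (\<integral>\<^sup>+x. (\<integral>\<^sup>+a. h (x(i := a)) \<partial>lborel) \<partial>PiM I (\<lambda>_. lborel))"
  proof (rule insert.IH)
    fix x y :: "'i \<Rightarrow> real"
    assume xy: "x \<in> space (PiM I (\<lambda>_. lborel))" "y \<in> space (PiM I (\<lambda>_. lborel))"
    let ?z = "\<lambda>j\<in>I. t * x j + s * y j"
    have z: "?z \<in> space (PiM I (\<lambda>_. lborel))" by (auto simp: space_PiM)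
    show "geo_mean_le t s (\<integral>\<^sup>+a. f (x(i := a)) \<partial>lborel) (\<integral>\<^sup>+a. g (y(i := a)) \<partial>lborel)
        (\<integral>\<^sup>+a. h (?z(i := a)) \<partial>lborel)"
    proof (rule prekopa_leindler_real)
      fix a b :: real
      have "(\<lambda>j\<in>insert i I. t * (x(i := a)) j + s * (y(i := b)) j) = ?z(i := t * a + s * b)"
        using insert.hyps by (auto simp: fun_eq_iff)
      then show "geo_mean_le t s (f (x(i := a))) (g (y(i := b))) (h (?z(i := t * a + s * b)))"
        using insert.prems(4)[OF upd[OF xy(1)] upd[OF xy(2)], of a b] by (simp only:)
    qed (use ts xy z in \<open>measurable\<close>)
  qed measurable
  then show ?case using insert.hyps by (simp add: product_nn_integral_insert)
qed

theorem prekopa_leindler: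
  fixes f g h :: "'a::euclidean_space \<Rightarrow> ennreal"
  assumes [measurable]: "f \<in> borel_measurable borel" "g \<in> borel_measurable borel" "h \<in> borel_measurable borel"
    and ts: "t > 0" "s > 0" "t + s = 1"
    and gm: "\<And>x y. geo_mean_le t s (f x) (g y) (h (t *\<^sub>R x + s *\<^sub>R y))"
  shows "geo_mean_le t s (\<integral>\<^sup>+x. f x \<partial>lborel) (\<integral>\<^sup>+x. g x \<partial>lborel) (\<integral>\<^sup>+x. h x \<partial>lborel)"
proof -
  define \<phi> :: "('a \<Rightarrow> real) \<Rightarrow> 'a" where "\<phi> x = (\<Sum>b\<in>Basis. x b *\<^sub>R b)" for x
  have [measurable]: "\<phi> \<in> measurable (PiM Basis (\<lambda>_. lborel)) borel" unfolding \<phi>_def by measurable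
  have eq: "(\<integral>\<^sup>+x. u x \<partial>lborel) = (\<integral>\<^sup>+x. u (\<phi> x) \<partial>PiM Basis (\<lambda>_. lborel))"
    if [measurable]: "u \<in> borel_measurable borel" for u :: "'a \<Rightarrow> ennreal"
    by (subst lborel_eq) (simp add: nn_integral_distr flip: \<phi>_def)
  have "\<phi> (\<lambda>i\<in>Basis. t * x i + s * y i) = t *\<^sub>R \<phi> x + s *\<^sub>R \<phi> y" for x y
    by (simp add: \<phi>_def scaleR_sum_right sum.distrib[symmetric] algebra_simps)
  then show ?thesis unfolding eq[OF assms(1)] eq[OF assms(2)] eq[OF assms(3)]
    using ts gm by (intro prekopa_leindler_PiM) auto
qed

section \<open>Entropy bounds for Gibbs measures\<close>

lemma sets_gibbs [simp, measurable_cong]: "sets (gibbs U) = sets borel"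
  and space_gibbs [simp]: "space (gibbs U) = UNIV"
  by (simp_all add: gibbs_def)

lemma measurable_gibbs1 [simp]: "measurable (gibbs U) N = measurable borel N"
  by (rule measurable_cong_sets) simp_all

lemma prob_space_gibbs:
  assumes "integrable lborel (\<lambda>x. exp (- U x))"
  shows "prob_space (gibbs U)" and "0 < (\<integral>x. exp (- U x) \<partial>lborel)"
proof -
  let ?Z = "\<integral>x. exp (- U x) \<partial>lborel"
  have [measurable]: "(\<lambda>x. exp (- U x)) \<in> borel_measurable borel"
    using borel_measurable_integrable[OF assms] by simp
  have "?Z \<noteq> 0"
  proof
    assume "?Z = 0"
    then have "AE x in lborel. exp (- U x) = 0"
      using integral_nonneg_eq_0_iff_AE[OF assms] by simp
    then have "AE x in (lborel :: 'a measure). False" by simp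
    then have "emeasure (lborel :: 'a measure) UNIV = 0" by (subst (asm) AE_iff_measurable[OF _ refl]) auto
    then show False by simp
  qed
  moreover have "?Z \<ge> 0" by simp
  ultimately show Z: "?Z > 0" by linarith
  show "prob_space (gibbs U)"
  proof
    have "emeasure (gibbs U) (space (gibbs U)) = (\<integral>\<^sup>+x. ennreal (exp (- U x) / ?Z) \<partial>lborel)"
      by (simp add: gibbs_def emeasure_density)
    also have "\<dots> = ennreal (\<integral>x. exp (- U x) / ?Z \<partial>lborel)"
      using assms Z by (intro nn_integral_eq_integral) auto
    also have "\<dots> = 1" using Z by simp
    finally show "emeasure (gibbs U) (space (gibbs U)) = 1" .
  qed
qed

lemma (in prob_space) integrable_bounded:
  fixes f :: "'a \<Rightarrow> real"
  assumes "f \<in> borel_measurable M" "\<And>x. \<bar>f x\<bar> \<le> B"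
  shows "integrable M f"
  using assms by (intro integrable_const_bound[where B=B]) auto

text \<open>The second function is the constant 1, whose integral is 1, so its factor drops out of
  the conclusion. What remains says that the convexity defect of U may pay for the excess of
  \<open>t * A\<close> over W.\<close>

lemma prekopa_leindler_gibbs:
  fixes U A W :: "'a::euclidean_space \<Rightarrow> real"
  assumes int: "integrable lborel (\<lambda>x. exp (- U x))"
    and [measurable]: "U \<in> borel_measurable borel" "A \<in> borel_measurable borel" "W \<in> borel_measurable borel"
    and intA: "integrable (gibbs U) (\<lambda>x. exp (A x))" and intW: "integrable (gibbs U) (\<lambda>x. exp (W x))"
    and ts: "t > 0" "s > 0" "t + s = 1"
    and le: "\<And>x y. t * A x - (t * U x + s * U y - U (t *\<^sub>R x + s *\<^sub>R y)) \<le> W (t *\<^sub>R x + s *\<^sub>R y)"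
  shows "(\<integral>x. exp (A x) \<partial>gibbs U) powr t \<le> (\<integral>x. exp (W x) \<partial>gibbs U)"
proof -
  define Z where "Z = (\<integral>x. exp (- U x) \<partial>lborel)"
  interpret \<mu>: prob_space "gibbs U" by (rule prob_space_gibbs(1)[OF int])
  have Z: "Z > 0" unfolding Z_def by (rule prob_space_gibbs(2)[OF int])
  \<comment> \<open>The normalisation sits in the exponent, where \<open>t + s = 1\<close> makes its
    contributions on the two sides agree.\<close>
  define F where "F V x = ennreal (exp (V x - U x - ln Z))" for V :: "'a \<Rightarrow> real" and x
  have [measurable]: "F V \<in> borel_measurable borel" if [measurable]: "V \<in> borel_measurable borel" for V
    unfolding F_def by measurable
  have F: "(\<integral>\<^sup>+x. F V x \<partial>lborel) = ennreal (\<integral>x. exp (V x) \<partial>gibbs U)"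
    if [measurable]: "V \<in> borel_measurable borel" and i: "integrable (gibbs U) (\<lambda>x. exp (V x))" for V
  proof -
    have "F V x = ennreal (exp (- U x) / Z) * ennreal (exp (V x))" for x
      using Z by (simp add: F_def ennreal_mult[symmetric] exp_diff exp_minus exp_add field_simps)
    then have "(\<integral>\<^sup>+x. F V x \<partial>lborel) = (\<integral>\<^sup>+x. ennreal (exp (V x)) \<partial>gibbs U)"
      unfolding gibbs_def Z_def by (subst nn_integral_density) (auto intro!: nn_integral_cong)
    also have "\<dots> = ennreal (\<integral>x. exp (V x) \<partial>gibbs U)"
      using i by (intro nn_integral_eq_integral) auto
    finally show ?thesis .
  qed
  have gm: "geo_mean_le t s (F A x) (F (\<lambda>_. 0) y) (F W (t *\<^sub>R x + s *\<^sub>R y))" for x y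
    unfolding geo_mean_le_def
  proof (intro allI impI)
    fix a b :: real
    assume ab: "a > 0" "b > 0" "ennreal a \<le> F A x" "ennreal b \<le> F (\<lambda>_. 0) y"
    have "a powr t * b powr s \<le> exp (A x - U x - ln Z) powr t * exp (0 - U y - ln Z) powr s"
      using ab ts by (intro mult_mono powr_mono2) (auto simp: F_def)
    also have "\<dots> = exp (t * A x - (t * U x + s * U y) - (t + s) * ln Z)"
      by (simp add: exp_powr_real algebra_simps flip: exp_add)
    also have "\<dots> \<le> exp (W (t *\<^sub>R x + s *\<^sub>R y) - U (t *\<^sub>R x + s *\<^sub>R y) - ln Z)"
      using le[of x y] ts by simp
    finally show "ennreal (a powr t * b powr s) \<le> F W (t *\<^sub>R x + s *\<^sub>R y)"
      unfolding F_def by (rule ennreal_leI)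
  qed
  define a where "a = (\<integral>x. exp (A x) \<partial>gibbs U)"
  have "0 \<le> a" unfolding a_def by simp
  show ?thesis
  proof (cases "a = 0")
    case True then show ?thesis using ts by (simp flip: a_def)
  next
    case False
    with \<open>0 \<le> a\<close> have "a > 0" by simp
    have "ennreal (a powr t * 1 powr s) \<le> (\<integral>\<^sup>+x. F W x \<partial>lborel)"
    proof (rule geo_mean_leD[OF prekopa_leindler[where f="F A" and g="F (\<lambda>_. 0)"]])
      show "ennreal a \<le> integral\<^sup>N lborel (F A)" using F[OF _ intA] by (simp add: a_def)
      show "ennreal 1 \<le> integral\<^sup>N lborel (F (\<lambda>_. 0))" using F[of "\<lambda>_. 0"] \<mu>.prob_space by simp
    qed (use ts gm \<open>a > 0\<close> in auto)
    then show ?thesis using F[OF _ intW] by (simp add: a_def)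
  qed
qed

section \<open>Lower bounds from the monotone gradient\<close>

locale power_convex_potential =
  fixes U :: "'a::euclidean_space \<Rightarrow> real" and gradU :: "'a \<Rightarrow> 'a" and K \<beta> :: real
  assumes gradU: "\<And>x. (U has_derivative (\<lambda>h. gradU x \<bullet> h)) (at x)"
    and integrable_Z: "integrable lborel (\<lambda>x. exp (- U x))"
    and K_pos: "K > 0"
    and beta_ge: "\<beta> \<ge> 1"
    and convex: "\<And>x y. (gradU x - gradU y) \<bullet> (x - y) \<ge> K * norm (x - y) powr (2 * \<beta>)"
begin

sublocale gibbs: prob_space "gibbs U" by (rule prob_space_gibbs(1)[OF integrable_Z])

text \<open>The scale at which the power becomes a power of a quadratic: \<open>(\<kappa> *
  r\<^sup>2) powr \<beta> = K * r powr (2 * \<beta>)\<close>.\<close>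

definition "\<kappa> = K powr (1 / \<beta>)"

lemma kappa_pos: "\<kappa> > 0" using K_pos by (simp add: \<kappa>_def)

lemma U_measurable [measurable]: "U \<in> borel_measurable borel"
  using gradU by (intro borel_measurable_continuous_onI continuous_at_imp_continuous_on)
    (auto intro: has_derivative_continuous)

text \<open>Along the segment from x, the hypothesis bounds the growth of the directional derivative
  below by \<open>K * norm d powr (2 * \<beta>) * \<tau> powr (2 * \<beta> - 1)\<close>; integration
  over \<tau> in (0, 1) produces the factor \<open>1 / (2 * \<beta>)\<close>.\<close>

lemma bregman_power_lower_bound:
  "U x + gradU x \<bullet> d + K / (2 * \<beta>) * norm d powr (2 * \<beta>) \<le> U (x + d)"
proof -
  \<comment> \<open>The last term is the antiderivative of the guaranteed growth, so the claim
    becomes monotonicity of \<phi>.\<close>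
  define \<phi> where "\<phi> \<tau> = U (x + \<tau> *\<^sub>R d) - \<tau> * (gradU x \<bullet> d) - K / (2 * \<beta>) * norm d powr (2 * \<beta>) * \<tau> powr (2 * \<beta>)" for \<tau> :: real
  have dU: "((\<lambda>\<tau>. U (x + \<tau> *\<^sub>R d)) has_real_derivative gradU (x + \<tau> *\<^sub>R d) \<bullet> d) (at \<tau>)" for \<tau>
  proof -
    have "((\<lambda>\<tau>. U (x + \<tau> *\<^sub>R d)) has_derivative (\<lambda>h. gradU (x + \<tau> *\<^sub>R d) \<bullet> (h *\<^sub>R d))) (at \<tau>)"
      by (rule has_derivative_compose[OF _ gradU]) (auto intro!: derivative_eq_intros)
    then show ?thesis by (simp add: has_field_derivative_def mult_commute_abs)
  qed
  have "\<phi> 0 \<le> \<phi> 1"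
  proof (rule DERIV_nonneg_imp_increasing_open[of 0 1 \<phi>])
    have "continuous_on {0..1} (\<lambda>\<tau>. U (x + \<tau> *\<^sub>R d))"
      by (rule DERIV_continuous_on) (rule DERIV_subset[OF dU subset_UNIV])
    moreover have "continuous_on {0..1} (\<lambda>\<tau>::real. \<tau> powr (2 * \<beta>))"
      using beta_ge by (intro continuous_on_powr' continuous_intros) auto
    ultimately show "continuous_on {0..1} \<phi>" unfolding \<phi>_def
      by (intro continuous_on_diff continuous_on_mult continuous_on_const continuous_on_id)
    fix \<tau> :: real assume \<tau>: "0 < \<tau>" "\<tau> < 1"
    have "(\<phi> has_real_derivative gradU (x + \<tau> *\<^sub>R d) \<bullet> d - gradU x \<bullet> d
        - K / (2 * \<beta>) * norm d powr (2 * \<beta>) * (2 * \<beta> * \<tau> powr (2 * \<beta> - 1))) (at \<tau>)"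
      unfolding \<phi>_def using \<tau> by (auto intro!: derivative_eq_intros dU)
    moreover have "0 \<le> gradU (x + \<tau> *\<^sub>R d) \<bullet> d - gradU x \<bullet> d
        - K / (2 * \<beta>) * norm d powr (2 * \<beta>) * (2 * \<beta> * \<tau> powr (2 * \<beta> - 1))"
    proof -
      \<comment> \<open>The hypothesis for the pair \<open>x + \<tau> *\<^sub>R d\<close>, x carries
        one surplus factor \<tau> on both sides, which is cancelled.\<close>
      have "norm (\<tau> *\<^sub>R d) powr (2 * \<beta>) = \<tau> powr (2 * \<beta>) * norm d powr (2 * \<beta>)"
        using \<tau> by (simp add: powr_mult)
      moreover have "\<tau> powr (2 * \<beta>) = \<tau> powr (2 * \<beta> - 1) * \<tau>"
        using \<tau> powr_add[of \<tau> "2 * \<beta> - 1" 1] by simp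
      ultimately have "\<tau> * (K * norm d powr (2 * \<beta>) * \<tau> powr (2 * \<beta> - 1)) = K * norm (\<tau> *\<^sub>R d) powr (2 * \<beta>)"
        by simp
      also have "\<dots> \<le> \<tau> * ((gradU (x + \<tau> *\<^sub>R d) - gradU x) \<bullet> d)"
        using convex[of "x + \<tau> *\<^sub>R d" x] by simp
      finally have "\<tau> * (K * norm d powr (2 * \<beta>) * \<tau> powr (2 * \<beta> - 1)) \<le> \<tau> * ((gradU (x + \<tau> *\<^sub>R d) - gradU x) \<bullet> d)" .
      then have "K * norm d powr (2 * \<beta>) * \<tau> powr (2 * \<beta> - 1) \<le> (gradU (x + \<tau> *\<^sub>R d) - gradU x) \<bullet> d"
        using \<tau> by simp
      then show ?thesis using beta_ge by (simp add: inner_diff_left)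
    qed
    ultimately show "\<exists>y. (\<phi> has_real_derivative y) (at \<tau>) \<and> 0 \<le> y" by blast
  qed simp
  then show ?thesis using beta_ge by (simp add: \<phi>_def)
qed

lemma power_ge_quadratic:
  assumes "r \<ge> 0"
  shows "\<kappa> / 2 * r\<^sup>2 - 1 / 2 \<le> K / (2 * \<beta>) * r powr (2 * \<beta>)"
proof (cases "r = 0")
  case True then show ?thesis by simp
next
  case False
  with assms have r: "r > 0" by simp
  define w where "w = \<kappa> * r\<^sup>2"
  have w: "w > 0" using r kappa_pos by (simp add: w_def)
  have wK: "w powr \<beta> = K * r powr (2 * \<beta>)"
  proof -
    have "w powr \<beta> = \<kappa> powr \<beta> * (r powr 2) powr \<beta>"
      using r kappa_pos by (simp add: w_def powr_mult)
    then show ?thesis using beta_ge K_pos by (simp add: \<kappa>_def powr_powr)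
  qed
  \<comment> \<open>Weighted arithmetic-geometric mean with weights \<open>1 / \<beta>\<close> and
    \<open>1 - 1 / \<beta>\<close> against the number 1. Bounding the remainder
    \<open>1 - 1 / \<beta>\<close> by 1 makes the loss independent of \<beta>; halving it gives the
    1/2.\<close>
  have "w = (w powr \<beta>) powr (1 / \<beta>) * 1 powr (1 - 1 / \<beta>)" using beta_ge w by (simp add: powr_powr)
  also have "\<dots> \<le> 1 / \<beta> * w powr \<beta> + (1 - 1 / \<beta>) * 1"
    using beta_ge w by (intro Youngs_inequality_0) auto
  finally have "w \<le> 1 / \<beta> * w powr \<beta> + 1" using beta_ge by (smt (verit) divide_nonneg_nonneg)
  then show ?thesis unfolding wK unfolding w_def by (simp add: field_simps)
qed

lemma bregman_quadratic_lower_bound: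
  "U x + gradU x \<bullet> d + (\<kappa> / 2 * (norm d)\<^sup>2 - 1 / 2) \<le> U (x + d)"
  using bregman_power_lower_bound[of x d] power_ge_quadratic[of "norm d"] by simp

text \<open>The barycentre z splits into a near point at displacement
  \<open>\<sigma> *\<^sub>R d\<close> and a far point at displacement \<open>- d\<close>. Because
  \<open>t * \<sigma> = s\<close>, the gradient terms cancel, and the quadratic gain at the far
  point enters with weight s, that is, at first order in \<sigma>.\<close>

lemma convexity_defect:
  assumes "\<sigma> > 0" "t = 1 / (1 + \<sigma>)" "s = \<sigma> / (1 + \<sigma>)"
  shows "s * (\<kappa> / 2 * (norm d)\<^sup>2 - 1 / 2) \<le> t * U (z + \<sigma> *\<^sub>R d) + s * U (z - d) - U z"
proof -
  have ts: "t > 0" "s > 0" "t + s = 1" "t * \<sigma> = s" using assms by (auto simp: add_divide_distrib[symmetric])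
  \<comment> \<open>At the near point only plain convexity is used. The quadratic bound would cost
    \<open>t / 2\<close> there, which does not vanish with \<sigma>.\<close>
  have "U z + gradU z \<bullet> (\<sigma> *\<^sub>R d) \<le> U (z + \<sigma> *\<^sub>R d)"
    using bregman_power_lower_bound[of z "\<sigma> *\<^sub>R d"] K_pos beta_ge
    by (smt (verit) divide_nonneg_nonneg mult_nonneg_nonneg powr_ge_zero)
  then have 1: "t * (U z + \<sigma> * (gradU z \<bullet> d)) \<le> t * U (z + \<sigma> *\<^sub>R d)"
    using ts by (intro mult_left_mono) auto
  have 2: "s * (U z - gradU z \<bullet> d + (\<kappa> / 2 * (norm d)\<^sup>2 - 1 / 2)) \<le> s * U (z - d)"
    using bregman_quadratic_lower_bound[of z "- d"] ts by (intro mult_left_mono) auto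
  have "t * (U z + \<sigma> * (gradU z \<bullet> d)) = t * U z + s * (gradU z \<bullet> d)"
    using ts(4) by (simp add: algebra_simps flip: mult.assoc)
  moreover have "t * U z + s * U z = U z" using ts(3) by (metis distrib_right mult_1)
  ultimately show ?thesis using 1 2 by (simp only: distrib_left right_diff_distrib)
qed

section \<open>First-order expansion of Prekopa-Leindler\<close>

text \<open>The increment of G at the near point must be bounded by its gradient at z, uniformly in
  z. Uniform continuity of \<open>DG\<close> allows this up to an error \<eta>, which stays fixed
  here while \<sigma> tends to 0.\<close>

lemma entropy_gradient_bound_approx:
  fixes G :: "'a \<Rightarrow> real" and DG :: "'a \<Rightarrow> 'a"
  assumes DG: "\<And>x. (G has_derivative (\<lambda>h. DG x \<bullet> h)) (at x)"
    and G_bd: "\<And>x. \<bar>G x\<bar> \<le> B" and DG_bd: "\<And>x. norm (DG x) \<le> M"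
    and uc: "uniformly_continuous_on UNIV DG"
    and norm1: "(\<integral>x. exp (G x) \<partial>gibbs U) = 1" and \<eta>: "\<eta> > 0"
  shows "(\<integral>x. G x * exp (G x) \<partial>gibbs U)
    \<le> (\<integral>x. (1 / 2 + (norm (DG x))\<^sup>2 / \<kappa> + 3 * \<eta>\<^sup>2 / \<kappa>) * exp (G x) \<partial>gibbs U)"
proof -
  define \<Phi> where "\<Phi> x = 1 / 2 + (norm (DG x))\<^sup>2 / \<kappa> + 3 * \<eta>\<^sup>2 / \<kappa>" for x
  define N where "N = 1 / 2 + M\<^sup>2 / \<kappa> + 3 * \<eta>\<^sup>2 / \<kappa>"
  define E where "E = (\<integral>x. G x * exp (G x) \<partial>gibbs U)"
  define P where "P = (\<integral>x. \<Phi> x * exp (G x) \<partial>gibbs U)"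
  have \<kappa>: "\<kappa> > 0" by (rule kappa_pos)
  have M: "M \<ge> 0" using DG_bd[of 0] norm_ge_zero order_trans by blast
  have B: "B \<ge> 0" using G_bd[of 0] by linarith
  have [measurable]: "G \<in> borel_measurable borel"
    using DG by (intro borel_measurable_continuous_onI continuous_at_imp_continuous_on)
      (auto intro: has_derivative_continuous)
  have [measurable]: "DG \<in> borel_measurable borel"
    by (intro borel_measurable_continuous_onI uniformly_continuous_imp_continuous uc)
  have [measurable]: "\<Phi> \<in> borel_measurable borel" unfolding \<Phi>_def by measurable
  have \<Phi>: "0 \<le> \<Phi> x" "\<Phi> x \<le> N" for x
    using \<kappa> DG_bd[of x] by (auto simp: \<Phi>_def N_def intro!: add_mono divide_right_mono power_mono)
  have N: "N > 0" using \<kappa> by (auto simp: N_def intro!: add_pos_nonneg)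
  have expG: "exp (G x) \<le> exp B" for x using G_bd[of x] by simp
  have int_expG: "integrable (gibbs U) (\<lambda>x. exp (G x))"
    by (rule gibbs.integrable_bounded[where B="exp B"]) (auto intro: abs_le_D1[OF G_bd])
  have int_GexpG: "integrable (gibbs U) (\<lambda>x. G x * exp (G x))"
    by (rule gibbs.integrable_bounded[where B="B * exp B"])
       (auto simp: abs_mult intro!: mult_mono G_bd expG B)
  have int_\<Phi>: "integrable (gibbs U) (\<lambda>x. \<Phi> x * exp (G x))"
    by (rule gibbs.integrable_bounded[where B="N * exp B"])
       (use \<Phi> N in \<open>auto simp: abs_mult intro!: mult_mono expG\<close>)
  obtain \<delta> where \<delta>: "\<delta> > 0" "\<And>x y. norm (x - y) < \<delta> \<Longrightarrow> norm (DG x - DG y) < \<eta>"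
    using uc \<eta> unfolding uniformly_continuous_on_def dist_norm by (metis UNIV_I)
  \<comment> \<open>Used twice: with the local bound \<open>norm (DG z) + \<eta>\<close> for small
    displacements, and with the global bound M for large ones.\<close>
  have lip: "\<bar>G (z + v) - G z\<bar> \<le> L * norm v"
    if "\<And>x. norm (x - z) \<le> norm v \<Longrightarrow> norm (DG x) \<le> L" for z v L
  proof -
    have "norm (G (z + v) - G z) \<le> L * norm (z + v - z)"
    proof (rule differentiable_bound[of "cball z (norm v)" G "\<lambda>x h. DG x \<bullet> h"])
      fix x assume "x \<in> cball z (norm v)"
      then have "norm (DG x) \<le> L" using that[of x] by (simp add: dist_norm norm_minus_commute)
      then show "onorm (\<lambda>h. DG x \<bullet> h) \<le> L"
        by (intro onorm_bound) (auto intro: order_trans[OF _ mult_right_mono] Cauchy_Schwarz_ineq2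
              order_trans[OF norm_ge_zero])
    qed (auto intro: has_derivative_at_withinI DG simp: dist_norm)
    then show ?thesis by simp
  qed
  \<comment> \<open>Prekopa-Leindler with weights \<open>t = 1 / (1 + \<sigma>)\<close>, \<open>s = \<sigma> / (1 + \<sigma>)\<close>; the claim is the first-order
    term as \<open>\<sigma>\<close> tends to 0.\<close>
  define \<sigma>0 where "\<sigma>0 = min (1 / 5) (min (1 / N) (\<delta> * \<kappa> / (4 * (M + 1))))"
  have \<sigma>0: "\<sigma>0 > 0" using N \<delta> \<kappa> M by (simp add: \<sigma>0_def)
  have step: "1 + \<sigma> * E \<le> exp (\<sigma> * (P + \<sigma> * N\<^sup>2))" if \<sigma>: "0 < \<sigma>" "\<sigma> \<le> \<sigma>0" for \<sigma>
  proof -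
    define t where "t = 1 / (1 + \<sigma>)"
    define s where "s = \<sigma> / (1 + \<sigma>)"
    have ts: "t > 0" "s > 0" "t + s = 1" "t * \<sigma> = s" "s * (1 + \<sigma>) = \<sigma>" "t * (1 + \<sigma>) = 1"
      using \<sigma> by (auto simp: t_def s_def add_divide_distrib[symmetric])
    \<comment> \<open>Each bound in \<open>\<sigma>0\<close> has one use: 1/5 keeps
      \<open>(1 + \<sigma>)\<^sup>2\<close> below 3/2, \<open>1 / N\<close> permits the quadratic
      bound on the exponential of \<open>s * \<Phi>\<close>, and the last lets the quadratic in d
      beat the Lipschitz bound M once the displacement exceeds \<delta>.\<close>
    have \<sigma>5: "\<sigma> \<le> 1 / 5" and \<sigma>N: "\<sigma> * N \<le> 1" and \<sigma>\<delta>: "\<sigma> * (4 * (M + 1)) \<le> \<delta> * \<kappa>"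
      using \<sigma> N M by (auto simp: \<sigma>0_def field_simps)
    have s_le: "s \<le> \<sigma>" using \<sigma> ts by (simp add: s_def divide_le_eq)
    have norm_scale: "norm (\<sigma> *\<^sub>R d) = s * (1 + \<sigma>) * norm d" for d :: 'a
      unfolding ts(5) using \<sigma> by simp
    have growth: "G (z + \<sigma> *\<^sub>R d) - G z \<le> s * (\<kappa> / 2 * (norm d)\<^sup>2 + (norm (DG z))\<^sup>2 / \<kappa> + 3 * \<eta>\<^sup>2 / \<kappa>)" for z d
    proof (cases "\<sigma> * norm d < \<delta>")
      case True
      define r where "r = norm (DG z) + \<eta>"
      have "G (z + \<sigma> *\<^sub>R d) - G z \<le> r * norm (\<sigma> *\<^sub>R d)"
      proof (rule order_trans[OF abs_ge_self lip])
        fix x assume "norm (x - z) \<le> norm (\<sigma> *\<^sub>R d)"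
        then have "norm (x - z) < \<delta>" using True \<sigma> by simp
        then have "norm (DG x - DG z) < \<eta>" by (rule \<delta>)
        then show "norm (DG x) \<le> r" unfolding r_def using norm_triangle_sub[of "DG x" "DG z"] by linarith
      qed
      also have "\<dots> = s * ((1 + \<sigma>) * r * norm d)" unfolding norm_scale by (simp only: mult_ac)
      also have "\<dots> \<le> s * (\<kappa> / 2 * (norm d)\<^sup>2 + ((1 + \<sigma>) * r)\<^sup>2 / (2 * \<kappa>))"
      proof (intro mult_left_mono)
        \<comment> \<open>Completing the square splits off exactly the term
          \<open>\<kappa> / 2 * (norm d)\<^sup>2\<close> that the convexity defect will
          cancel.\<close>
        have "0 \<le> (\<kappa> * norm d - (1 + \<sigma>) * r)\<^sup>2 / (2 * \<kappa>)" using \<kappa> by simp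
        also have "\<dots> = \<kappa> / 2 * (norm d)\<^sup>2 + ((1 + \<sigma>) * r)\<^sup>2 / (2 * \<kappa>) - (1 + \<sigma>) * r * norm d"
          using \<kappa> by (simp add: power2_diff power_mult_distrib add_divide_distrib diff_divide_distrib power2_eq_square[of \<kappa>])
        finally show "(1 + \<sigma>) * r * norm d \<le> \<kappa> / 2 * (norm d)\<^sup>2 + ((1 + \<sigma>) * r)\<^sup>2 / (2 * \<kappa>)" by simp
      qed (use ts in auto)
      also have "\<dots> \<le> s * (\<kappa> / 2 * (norm d)\<^sup>2 + (2 * (norm (DG z))\<^sup>2 + 6 * \<eta>\<^sup>2) / (2 * \<kappa>))"
      proof (intro mult_left_mono add_left_mono divide_right_mono)
        \<comment> \<open>The optimal coefficient of the squared gradient would be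
          \<open>1 / (2 * \<kappa>)\<close>; \<open>1 / \<kappa>\<close> is kept instead. This
          factor 2 is spent as 3/2 for \<open>(1 + \<sigma>)\<^sup>2\<close> and 4/3 for separating
          \<eta> from the gradient.\<close>
        have "(1 + \<sigma>)\<^sup>2 \<le> (6 / 5)\<^sup>2" using \<sigma> \<sigma>5 by (intro power_mono) auto
        also have "\<dots> \<le> 3 / (2::real)" by (simp add: power2_eq_square)
        finally have 1: "(1 + \<sigma>)\<^sup>2 \<le> 3 / 2" .
        have "0 \<le> (norm (DG z) - 3 * \<eta>)\<^sup>2" by simp
        then have 2: "r\<^sup>2 \<le> 4 / 3 * (norm (DG z))\<^sup>2 + 4 * \<eta>\<^sup>2"
          by (simp add: r_def power2_eq_square algebra_simps)
        have "((1 + \<sigma>) * r)\<^sup>2 \<le> 3 / 2 * (4 / 3 * (norm (DG z))\<^sup>2 + 4 * \<eta>\<^sup>2)"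
          unfolding power_mult_distrib using 1 2 by (intro mult_mono) auto
        then show "((1 + \<sigma>) * r)\<^sup>2 \<le> 2 * (norm (DG z))\<^sup>2 + 6 * \<eta>\<^sup>2" by simp
      qed (use ts \<kappa> in auto)
      also have "\<dots> = s * (\<kappa> / 2 * (norm d)\<^sup>2 + (norm (DG z))\<^sup>2 / \<kappa> + 3 * \<eta>\<^sup>2 / \<kappa>)"
        using \<kappa> by (simp add: field_simps)
      finally show ?thesis .
    next
      case False
      \<comment> \<open>Here \<open>norm d\<close> is at least \<open>\<delta> / \<sigma>\<close>,
        so a linear function of it with slope M is dominated by the quadratic.\<close>
      have "M * (1 + \<sigma>) \<le> M * 2" using \<sigma>5 M by (intro mult_left_mono) auto
      then have "\<sigma> * (2 * (M * (1 + \<sigma>))) \<le> \<sigma> * (4 * (M + 1))"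
        using \<sigma> by (intro mult_left_mono) auto
      also have "\<dots> \<le> \<delta> * \<kappa>" by (rule \<sigma>\<delta>)
      also have "\<dots> \<le> \<sigma> * norm d * \<kappa>" using False \<kappa> by (intro mult_right_mono) auto
      finally have "\<sigma> * (M * (1 + \<sigma>)) \<le> \<sigma> * (\<kappa> / 2 * norm d)" by (simp add: mult_ac)
      then have Md: "M * (1 + \<sigma>) \<le> \<kappa> / 2 * norm d" using \<sigma>(1) by (rule mult_left_le_imp_le)
      have "G (z + \<sigma> *\<^sub>R d) - G z \<le> M * norm (\<sigma> *\<^sub>R d)"
        by (rule order_trans[OF abs_ge_self lip]) (rule DG_bd)
      also have "\<dots> = s * (M * (1 + \<sigma>) * norm d)" unfolding norm_scale by (simp only: mult_ac)
      also have "\<dots> \<le> s * (\<kappa> / 2 * norm d * norm d)"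
        using Md ts by (intro mult_left_mono mult_right_mono) auto
      also have "\<dots> \<le> s * (\<kappa> / 2 * (norm d)\<^sup>2 + (norm (DG z))\<^sup>2 / \<kappa> + 3 * \<eta>\<^sup>2 / \<kappa>)"
        using ts \<kappa> by (intro mult_left_mono) (auto simp: power2_eq_square)
      finally show ?thesis .
    qed
    \<comment> \<open>The term 1/2 in \<Phi> is the loss in the convexity defect; the squared
      gradient and \<eta> terms come from \<open>growth\<close>.\<close>
    define W where "W x = G x + s * \<Phi> x" for x
    have [measurable]: "W \<in> borel_measurable borel" unfolding W_def by measurable
    have sN: "s * N \<le> 1" using s_le \<sigma>N N by (meson mult_right_mono less_imp_le order_trans)
    have W_le: "W x \<le> B + 1" for x
    proof -
      have "s * \<Phi> x \<le> s * N" using \<Phi> ts by (intro mult_left_mono) auto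
      then show ?thesis unfolding W_def using sN G_bd[of x] by linarith
    qed
    have int_W: "integrable (gibbs U) (\<lambda>x. exp (W x))"
      by (rule gibbs.integrable_bounded[where B="exp (B + 1)"]) (auto intro: W_le)
    have int_A: "integrable (gibbs U) (\<lambda>x. exp ((1 + \<sigma>) * G x))"
    proof (rule gibbs.integrable_bounded[where B="exp ((1 + \<sigma>) * B)"])
      show "\<bar>exp ((1 + \<sigma>) * G x)\<bar> \<le> exp ((1 + \<sigma>) * B)" for x
        using G_bd[of x] \<sigma> by auto
    qed measurable
    have PL: "(\<integral>x. exp ((1 + \<sigma>) * G x) \<partial>gibbs U) powr t \<le> (\<integral>x. exp (W x) \<partial>gibbs U)"
    proof (rule prekopa_leindler_gibbs[OF integrable_Z _ _ _ int_A int_W])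
      fix x y :: 'a
      \<comment> \<open>Reading a pair x, y as near and far point about its barycentre:
        \<open>x = z + \<sigma> *\<^sub>R d\<close> and \<open>y = z - d\<close>.\<close>
      define z where "z = t *\<^sub>R x + s *\<^sub>R y"
      define d where "d = t *\<^sub>R (x - y)"
      have td: "\<sigma> *\<^sub>R d = s *\<^sub>R (x - y)" using ts(4) by (simp add: d_def mult.commute)
      have x: "x = z + \<sigma> *\<^sub>R d"
      proof -
        have "z + \<sigma> *\<^sub>R d = (t + s) *\<^sub>R x" unfolding td z_def by (simp add: algebra_simps)
        then show ?thesis using ts by simp
      qed
      have y: "y = z - d"
      proof -
        have "z - d = (t + s) *\<^sub>R y" unfolding d_def z_def by (simp add: algebra_simps)
        then show ?thesis using ts by simp
      qed
      have "t * ((1 + \<sigma>) * G x) = G x" using ts(6) by (simp flip: mult.assoc)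
      moreover have "s * (\<kappa> / 2 * (norm d)\<^sup>2 - 1 / 2) \<le> t * U x + s * U y - U z"
        unfolding x y by (rule convexity_defect) (use \<sigma> in \<open>auto simp: t_def s_def\<close>)
      moreover have "G x - G z \<le> s * (\<kappa> / 2 * (norm d)\<^sup>2 + (norm (DG z))\<^sup>2 / \<kappa> + 3 * \<eta>\<^sup>2 / \<kappa>)"
        unfolding x by (rule growth)
      ultimately have "t * ((1 + \<sigma>) * G x) - (t * U x + s * U y - U z) \<le> W z"
        unfolding W_def \<Phi>_def by (simp add: algebra_simps)
      then show "t * ((1 + \<sigma>) * G x) - (t * U x + s * U y - U (t *\<^sub>R x + s *\<^sub>R y)) \<le> W (t *\<^sub>R x + s *\<^sub>R y)"
        unfolding z_def .
    qed (use ts in auto)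
    \<comment> \<open>The entropy appears as the linear coefficient in \<sigma>, by
      \<open>1 + y \<le> exp y\<close>. Raising Prekopa-Leindler to the power
      \<open>1 + \<sigma>\<close> removes the exponent t, and
      \<open>s * (1 + \<sigma>) = \<sigma>\<close> restores the parameter \<sigma>.\<close>
    have "1 + \<sigma> * E = (\<integral>x. exp (G x) + \<sigma> * (G x * exp (G x)) \<partial>gibbs U)"
      using int_expG int_GexpG norm1 by (simp add: E_def)
    also have "\<dots> \<le> (\<integral>x. exp ((1 + \<sigma>) * G x) \<partial>gibbs U)"
    proof (rule integral_mono)
      fix x
      have "exp (G x) * (1 + \<sigma> * G x) \<le> exp (G x) * exp (\<sigma> * G x)"
        by (intro mult_left_mono exp_ge_add_one_self) auto
      then show "exp (G x) + \<sigma> * (G x * exp (G x)) \<le> exp ((1 + \<sigma>) * G x)"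
        by (simp add: algebra_simps exp_add)
    qed (use int_expG int_GexpG int_A in auto)
    also have "\<dots> = ((\<integral>x. exp ((1 + \<sigma>) * G x) \<partial>gibbs U) powr t) powr (1 + \<sigma>)"
      using ts(6) by (simp add: powr_powr integral_nonneg_AE)
    also have "\<dots> \<le> (\<integral>x. exp (W x) \<partial>gibbs U) powr (1 + \<sigma>)"
      using PL \<sigma> by (intro powr_mono2) auto
    also have "\<dots> \<le> exp (s * P + s\<^sup>2 * N\<^sup>2) powr (1 + \<sigma>)"
    proof (intro powr_mono2)
      have "(\<integral>x. exp (W x) \<partial>gibbs U) \<le> (\<integral>x. exp (G x) + s * (\<Phi> x * exp (G x)) + s\<^sup>2 * N\<^sup>2 * exp (G x) \<partial>gibbs U)"
      proof (rule integral_mono)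
        fix x
        have s\<Phi>: "0 \<le> s * \<Phi> x" "s * \<Phi> x \<le> s * N" using \<Phi> ts by (auto intro!: mult_left_mono)
        have "exp (s * \<Phi> x) \<le> 1 + s * \<Phi> x + (s * \<Phi> x)\<^sup>2"
          using s\<Phi> sN by (intro exp_bound) auto
        also have "(s * \<Phi> x)\<^sup>2 \<le> (s * N)\<^sup>2" using s\<Phi> by (intro power_mono) auto
        finally have "exp (G x) * exp (s * \<Phi> x) \<le> exp (G x) * (1 + s * \<Phi> x + (s * N)\<^sup>2)"
          by (intro mult_left_mono) auto
        then show "exp (W x) \<le> exp (G x) + s * (\<Phi> x * exp (G x)) + s\<^sup>2 * N\<^sup>2 * exp (G x)"
          by (simp add: W_def exp_add algebra_simps power_mult_distrib)
      qed (use int_W int_expG int_\<Phi> in auto)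
      also have "\<dots> = 1 + (s * P + s\<^sup>2 * N\<^sup>2)"
        using int_expG int_\<Phi> norm1 by (simp add: P_def)
      also have "\<dots> \<le> exp (s * P + s\<^sup>2 * N\<^sup>2)" by (rule exp_ge_add_one_self)
      finally show "(\<integral>x. exp (W x) \<partial>gibbs U) \<le> exp (s * P + s\<^sup>2 * N\<^sup>2)" .
    qed (use \<sigma> in auto)
    also have "\<dots> = exp ((s * (1 + \<sigma>)) * P + s * (s * (1 + \<sigma>)) * N\<^sup>2)"
      by (simp add: exp_powr_real algebra_simps power2_eq_square)
    also have "\<dots> = exp (\<sigma> * (P + s * N\<^sup>2))" unfolding ts(5) by (simp add: algebra_simps)
    also have "\<dots> \<le> exp (\<sigma> * (P + \<sigma> * N\<^sup>2))"
      using s_le \<sigma> by (auto intro!: mult_left_mono mult_right_mono)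
    finally show ?thesis .
  qed
  \<comment> \<open>Both sides of \<open>step\<close> equal 1 at \<sigma> = 0, so their right
    derivatives there are ordered: E on the left, P on the right.\<close>
  have "E \<le> P"
  proof (rule tendsto_le)
    show "((\<lambda>\<sigma>. E) \<longlongrightarrow> E) (at_right 0)" by simp
    have "((\<lambda>\<sigma>. exp (\<sigma> * (P + \<sigma> * N\<^sup>2))) has_real_derivative P) (at 0)"
      by (auto intro!: derivative_eq_intros)
    then have "((\<lambda>\<sigma>. (exp (\<sigma> * (P + \<sigma> * N\<^sup>2)) - 1) / \<sigma>) \<longlongrightarrow> P) (at 0)"
      by (simp add: has_field_derivative_iff)
    then show "((\<lambda>\<sigma>. (exp (\<sigma> * (P + \<sigma> * N\<^sup>2)) - 1) / \<sigma>) \<longlongrightarrow> P) (at_right 0)"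
      by (rule tendsto_within_subset) simp
    show "eventually (\<lambda>\<sigma>. E \<le> (exp (\<sigma> * (P + \<sigma> * N\<^sup>2)) - 1) / \<sigma>) (at_right 0)"
      unfolding eventually_at_right_field
    proof (intro exI[of _ \<sigma>0] conjI allI impI \<sigma>0)
      fix \<sigma> :: real assume "0 < \<sigma>" "\<sigma> < \<sigma>0"
      with step[of \<sigma>] show "E \<le> (exp (\<sigma> * (P + \<sigma> * N\<^sup>2)) - 1) / \<sigma>"
        by (simp add: field_simps)
    qed
  qed simp
  then show ?thesis unfolding E_def P_def \<Phi>_def .
qed

lemma entropy_gradient_bound:
  fixes G :: "'a \<Rightarrow> real" and DG :: "'a \<Rightarrow> 'a"
  assumes DG: "\<And>x. (G has_derivative (\<lambda>h. DG x \<bullet> h)) (at x)"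
    and G_bd: "\<And>x. \<bar>G x\<bar> \<le> B" and DG_bd: "\<And>x. norm (DG x) \<le> M"
    and uc: "uniformly_continuous_on UNIV DG"
  defines "m \<equiv> (\<integral>x. exp (G x) \<partial>gibbs U)"
  shows "(\<integral>x. G x * exp (G x) \<partial>gibbs U) - m * ln m
    \<le> (\<integral>x. (1 / 2 + (norm (DG x))\<^sup>2 / \<kappa>) * exp (G x) \<partial>gibbs U)"
proof -
  have \<kappa>: "\<kappa> > 0" by (rule kappa_pos)
  have M: "M \<ge> 0" using DG_bd[of 0] norm_ge_zero order_trans by blast
  have B: "B \<ge> 0" using G_bd[of 0] by linarith
  have [measurable]: "G \<in> borel_measurable borel"
    using DG by (intro borel_measurable_continuous_onI continuous_at_imp_continuous_on)
      (auto intro: has_derivative_continuous)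
  have [measurable]: "DG \<in> borel_measurable borel"
    by (intro borel_measurable_continuous_onI uniformly_continuous_imp_continuous uc)
  have expG: "exp (G x) \<le> exp B" for x using G_bd[of x] by simp
  have int_expG: "integrable (gibbs U) (\<lambda>x. exp (G x))"
    by (rule gibbs.integrable_bounded[where B="exp B"]) (auto intro: abs_le_D1[OF G_bd])
  have int_GexpG: "integrable (gibbs U) (\<lambda>x. G x * exp (G x))"
    by (rule gibbs.integrable_bounded[where B="B * exp B"])
       (auto simp: abs_mult intro!: mult_mono G_bd expG B)
  define \<Phi> where "\<Phi> x = 1 / 2 + (norm (DG x))\<^sup>2 / \<kappa>" for x
  have [measurable]: "\<Phi> \<in> borel_measurable borel" unfolding \<Phi>_def by measurable
  have \<Phi>: "0 \<le> \<Phi> x" "\<Phi> x \<le> 1 / 2 + M\<^sup>2 / \<kappa>" for x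
    using \<kappa> DG_bd[of x] by (auto simp: \<Phi>_def intro!: divide_right_mono power_mono)
  have int_\<Phi>: "integrable (gibbs U) (\<lambda>x. \<Phi> x * exp (G x))"
    by (rule gibbs.integrable_bounded[where B="(1 / 2 + M\<^sup>2 / \<kappa>) * exp B"])
       (use \<Phi> \<kappa> in \<open>auto simp: abs_mult intro!: mult_mono expG\<close>)
  have "exp (- B) = (\<integral>x. exp (- B) \<partial>gibbs U)" using gibbs.prob_space by simp
  also have "\<dots> \<le> m" unfolding m_def
  proof (rule integral_mono)
    show "exp (- B) \<le> exp (G x)" for x using G_bd[of x] by simp
  qed (use int_expG in auto)
  finally have m: "m > 0" by (rule less_le_trans[OF exp_gt_zero])
  have eq: "exp (G x - ln m) = exp (G x) / m" for x using m by (simp add: exp_diff)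
  \<comment> \<open>Subtracting \<open>ln m\<close> from G normalises the integral of its
    exponential to 1 and leaves the gradient unchanged.\<close>
  have approx: "(\<integral>x. G x * exp (G x) \<partial>gibbs U) - m * ln m
      \<le> (\<integral>x. \<Phi> x * exp (G x) \<partial>gibbs U) + 3 * \<eta>\<^sup>2 / \<kappa> * m" if "\<eta> > 0" for \<eta>
  proof -
    have "(\<integral>x. (G x - ln m) * exp (G x - ln m) \<partial>gibbs U)
      \<le> (\<integral>x. (1 / 2 + (norm (DG x))\<^sup>2 / \<kappa> + 3 * \<eta>\<^sup>2 / \<kappa>) * exp (G x - ln m) \<partial>gibbs U)"
    proof (rule entropy_gradient_bound_approx)
      show "((\<lambda>x. G x - ln m) has_derivative (\<lambda>h. DG x \<bullet> h)) (at x)" for x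
        by (auto intro!: derivative_eq_intros DG)
      show "\<bar>G x - ln m\<bar> \<le> B + \<bar>ln m\<bar>" for x using G_bd[of x] by linarith
      show "(\<integral>x. exp (G x - ln m) \<partial>gibbs U) = 1" unfolding eq using m by (simp add: m_def)
    qed (use DG_bd uc that in auto)
    also have "(\<integral>x. (G x - ln m) * exp (G x - ln m) \<partial>gibbs U)
        = (\<integral>x. (G x * exp (G x) - ln m * exp (G x)) / m \<partial>gibbs U)"
      unfolding eq by (simp add: left_diff_distrib)
    also have "\<dots> = ((\<integral>x. G x * exp (G x) \<partial>gibbs U) - m * ln m) / m"
      using int_expG int_GexpG by (simp add: m_def)
    also have "(\<integral>x. (1 / 2 + (norm (DG x))\<^sup>2 / \<kappa> + 3 * \<eta>\<^sup>2 / \<kappa>) * exp (G x - ln m) \<partial>gibbs U)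
        = (\<integral>x. (\<Phi> x * exp (G x) + 3 * \<eta>\<^sup>2 / \<kappa> * exp (G x)) / m \<partial>gibbs U)"
      unfolding eq \<Phi>_def[symmetric] by (simp add: distrib_right)
    also have "\<dots> = ((\<integral>x. \<Phi> x * exp (G x) \<partial>gibbs U) + 3 * \<eta>\<^sup>2 / \<kappa> * m) / m"
      using int_expG int_\<Phi> by (simp add: m_def)
    finally show ?thesis using m by (simp add: divide_le_cancel)
  qed
  have "(\<integral>x. G x * exp (G x) \<partial>gibbs U) - m * ln m \<le> (\<integral>x. \<Phi> x * exp (G x) \<partial>gibbs U) + 3 * 0\<^sup>2 / \<kappa> * m"
  proof (rule tendsto_lowerbound)
    show "((\<lambda>\<eta>. (\<integral>x. \<Phi> x * exp (G x) \<partial>gibbs U) + 3 * \<eta>\<^sup>2 / \<kappa> * m)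
       \<longlongrightarrow> (\<integral>x. \<Phi> x * exp (G x) \<partial>gibbs U) + 3 * 0\<^sup>2 / \<kappa> * m) (at_right 0)"
      using \<kappa> by (intro tendsto_intros) auto
    show "eventually (\<lambda>\<eta>. (\<integral>x. G x * exp (G x) \<partial>gibbs U) - m * ln m
       \<le> (\<integral>x. \<Phi> x * exp (G x) \<partial>gibbs U) + 3 * \<eta>\<^sup>2 / \<kappa> * m) (at_right 0)"
      unfolding eventually_at_right_field using approx by (intro exI[of _ 1]) auto
  qed simp
  then show ?thesis by (simp add: \<Phi>_def)
qed

end

section \<open>Defective log-Sobolev inequality\<close>

text \<open>Only l = 0 is delicate, where \<open>ln 0 = 0\<close> makes the limit value 0. There
  \<open>y * ln y\<close> is dominated by \<open>2 * sqrt y\<close>, which follows from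
  \<open>ln z \<le> z\<close> at \<open>z = 1 / sqrt y\<close>.\<close>

lemma tendsto_mult_ln_self:
  fixes g :: "'b \<Rightarrow> real"
  assumes g: "(g \<longlongrightarrow> l) F" and nonneg: "\<And>x. 0 \<le> g x"
  shows "((\<lambda>x. g x * ln (g x)) \<longlongrightarrow> l * ln l) F"
proof (cases "l = 0")
  case False
  then show ?thesis using g by (intro tendsto_intros) auto
next
  case True
  have "\<bar>y * ln y\<bar> \<le> 2 * sqrt y" if "0 \<le> y" "y \<le> 1" for y :: real
  proof (cases "y = 0")
    case False
    with that have y: "y > 0" by simp
    have "- ln y = 2 * ln (1 / sqrt y)" using y by (simp add: ln_div ln_sqrt)
    also have "\<dots> \<le> 2 * (1 / sqrt y)"
      using y ln_bound[of "1 / sqrt y"] by simp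
    finally have "y * (- ln y) \<le> y * (2 * (1 / sqrt y))" using y by (intro mult_left_mono) auto
    also have "\<dots> = 2 * (y / sqrt y)" by simp
    also have "\<dots> = 2 * sqrt y" using y by (simp only: real_div_sqrt less_imp_le)
    finally show ?thesis using that y by (simp add: abs_mult)
  qed simp
  moreover have "eventually (\<lambda>x. g x < 1) F" using order_tendstoD(2)[OF g, of 1] True by simp
  ultimately have "eventually (\<lambda>x. norm (g x * ln (g x)) \<le> 2 * sqrt (g x)) F"
    using nonneg by (auto elim!: eventually_mono)
  moreover have "((\<lambda>x. 2 * sqrt (g x)) \<longlongrightarrow> 2 * sqrt 0) F"
    using g True by (intro tendsto_intros) auto
  ultimately have "((\<lambda>x. g x * ln (g x)) \<longlongrightarrow> 0) F" by (auto intro: Lim_null_comparison)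
  then show ?thesis using True by simp
qed

text \<open>A uniform lower bound lets the entropy integrand be shifted by 1 into the range of
  Fatou's lemma.\<close>

lemma mult_ln_ge: "- 1 \<le> y * ln y" if "0 \<le> y" for y :: real
proof (cases "y = 0")
  case False
  with that have y: "y > 0" by simp
  have "1 - 1 / y \<le> ln y" using y ln_le_minus_one[of "1 / y"] by (simp add: ln_div)
  then have "y * (1 - 1 / y) \<le> y * ln y" using y by (intro mult_left_mono) auto
  then show ?thesis using y by (simp add: right_diff_distrib)
qed simp

text \<open>Used where no dominating function is at hand: bounds on the approximating integrals
  alone yield integrability of the limit as well as the limiting inequality.\<close>

lemma Fatou_integrable:
  fixes X :: "nat \<Rightarrow> 'b \<Rightarrow> real"
  assumes int: "\<And>n. integrable M (X n)" and nonneg: "\<And>n x. 0 \<le> X n x"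
    and lim: "\<And>x. (\<lambda>n. X n x) \<longlonglongrightarrow> Y x"
    and le: "\<And>n. (\<integral>x. X n x \<partial>M) \<le> c n" and c: "c \<longlonglongrightarrow> C"
  shows "integrable M Y" and "(\<integral>x. Y x \<partial>M) \<le> C"
proof -
  have [measurable]: "X n \<in> borel_measurable M" for n using int by auto
  have [measurable]: "Y \<in> borel_measurable M"
    by (rule borel_measurable_LIMSEQ_real[OF lim]) auto
  have Y: "0 \<le> Y x" for x using lim nonneg by (intro LIMSEQ_le_const[OF lim]) auto
  have c_nonneg: "0 \<le> c n" for n
  proof -
    have "0 \<le> (\<integral>x. X n x \<partial>M)" using nonneg by simp
    also note le[of n]
    finally show ?thesis .
  qed
  then have C: "0 \<le> C" by (intro LIMSEQ_le_const[OF c]) auto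
  have "(\<integral>\<^sup>+x. ennreal (Y x) \<partial>M) = (\<integral>\<^sup>+x. liminf (\<lambda>n. ennreal (X n x)) \<partial>M)"
    by (intro nn_integral_cong lim_imp_Liminf[symmetric] tendsto_ennrealI lim) simp
  also have "\<dots> \<le> liminf (\<lambda>n. \<integral>\<^sup>+x. ennreal (X n x) \<partial>M)"
    by (rule nn_integral_liminf) auto
  also have "\<dots> \<le> liminf (\<lambda>n. ennreal (c n))"
    using le by (intro Liminf_mono) (auto simp: nn_integral_eq_integral[OF int] nonneg ennreal_leI)
  also have "\<dots> = ennreal C" by (intro lim_imp_Liminf tendsto_ennrealI c) simp
  finally have fin: "(\<integral>\<^sup>+x. ennreal (Y x) \<partial>M) \<le> ennreal C" .
  then show "integrable M Y"
    by (intro integrableI_nonneg) (auto simp: Y intro: le_less_trans)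
  then have "(\<integral>\<^sup>+x. ennreal (Y x) \<partial>M) = ennreal (\<integral>x. Y x \<partial>M)"
    using Y by (intro nn_integral_eq_integral) auto
  with fin C show "(\<integral>x. Y x \<partial>M) \<le> C" by simp
qed

section \<open>Compact support and radial cutoffs\<close>

lemma compact_support_bounded:
  fixes u :: "'b::euclidean_space \<Rightarrow> 'c::real_normed_vector"
  assumes cont: "continuous_on UNIV u" and supp: "\<And>x. R < norm x \<Longrightarrow> u x = 0"
  obtains M where "M \<ge> 0" "\<And>x. norm (u x) \<le> M"
proof -
  have "bounded (u ` cball 0 R)"
    by (intro compact_imp_bounded compact_continuous_image continuous_on_subset[OF cont]) auto
  then obtain M where M: "\<And>x. x \<in> cball 0 R \<Longrightarrow> norm (u x) \<le> M"
    by (meson bounded_iff imageI)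
  show ?thesis
  proof (rule that[of "max 0 M"])
    fix x show "norm (u x) \<le> max 0 M"
    proof (cases "R < norm x")
      case False then show ?thesis using M[of x] by auto
    qed (auto simp: supp)
  qed simp
qed

lemma compact_support_uniformly_continuous:
  fixes u :: "'b::euclidean_space \<Rightarrow> 'c::real_normed_vector"
  assumes cont: "continuous_on UNIV u" and supp: "\<And>x. R < norm x \<Longrightarrow> u x = 0"
  shows "uniformly_continuous_on UNIV u"
  unfolding uniformly_continuous_on_def
proof (intro allI impI)
  fix e :: real assume e: "e > 0"
  \<comment> \<open>The extra unit of radius ensures that two points closer than 1 either both lie
    in this ball or both lie outside the support.\<close>
  have "uniformly_continuous_on (cball 0 (R + 1)) u"
    by (intro compact_uniformly_continuous continuous_on_subset[OF cont]) auto
  then obtain d where d: "d > 0" "\<And>x y. x \<in> cball 0 (R + 1) \<Longrightarrow> y \<in> cball 0 (R + 1) \<Longrightarrow> dist y x < d \<Longrightarrow> dist (u y) (u x) < e"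
    using e unfolding uniformly_continuous_on_def by metis
  show "\<exists>d>0. \<forall>x\<in>UNIV. \<forall>y\<in>UNIV. dist y x < d \<longrightarrow> dist (u y) (u x) < e"
  proof (intro exI[of _ "min d 1"] conjI ballI impI)
    fix x y :: 'b assume xy: "dist y x < min d 1"
    show "dist (u y) (u x) < e"
    proof (cases "x \<in> cball 0 (R + 1) \<and> y \<in> cball 0 (R + 1)")
      case True then show ?thesis using d(2)[of x y] xy by simp
    next
      case False
      have "norm x \<le> norm y + dist y x" "norm y \<le> norm x + dist y x"
        using norm_triangle_ineq2[of x y] norm_triangle_ineq2[of y x] by (auto simp: dist_norm norm_minus_commute)
      then have "R < norm x" "R < norm y" using False xy by auto
      then show ?thesis using supp e by simp
    qed
  qed (use d in auto)
qed

lemma DERIV_max_0_power2: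
  "((\<lambda>u::real. (max 0 u)\<^sup>2) has_real_derivative 2 * max 0 u) (at u)"
proof -
  consider "u > 0" | "u < 0" | "u = 0" by linarith
  then show ?thesis
  proof cases
    case 1
    have "((\<lambda>u::real. u\<^sup>2) has_real_derivative 2 * max 0 u) (at u)"
      using 1 by (auto intro!: derivative_eq_intros)
    then show ?thesis
      by (rule has_field_derivative_transform_within_open[of _ _ _ "{0<..}"]) (use 1 in auto)
  next
    case 2
    have "((\<lambda>u::real. 0) has_real_derivative 2 * max 0 u) (at u)"
      using 2 by (auto intro!: derivative_eq_intros)
    then show ?thesis
      by (rule has_field_derivative_transform_within_open[of _ _ _ "{..<0}"]) (use 2 in auto)
  next
    case 3
    have "\<bar>(max 0 h)\<^sup>2 / h\<bar> \<le> \<bar>h\<bar>" for h :: real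
      by (auto simp: max_def power2_eq_square)
    then have "((\<lambda>h::real. (max 0 h)\<^sup>2 / h) \<longlongrightarrow> 0) (at 0)"
      by (intro Lim_null_comparison[OF _ tendsto_rabs_zero[OF tendsto_ident_at]]) simp
    then show ?thesis using 3 by (simp add: has_field_derivative_iff)
  qed
qed

text \<open>The outer square makes the positive part continuously differentiable across the sphere
  of radius R; a function of \<open>x \<bullet> x\<close> is moreover smooth at the origin.\<close>

definition cutoff :: "real \<Rightarrow> 'b::euclidean_space \<Rightarrow> real" where
  "cutoff R x = (max 0 (1 - (x \<bullet> x) / R\<^sup>2))\<^sup>2"

definition grad_cutoff :: "real \<Rightarrow> 'b::euclidean_space \<Rightarrow> 'b" where
  "grad_cutoff R x = (- 4 * max 0 (1 - (x \<bullet> x) / R\<^sup>2) / R\<^sup>2) *\<^sub>R x"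

lemma has_derivative_cutoff: "(cutoff R has_derivative (\<lambda>h. grad_cutoff R x \<bullet> h)) (at x)"
proof -
  have "((\<lambda>x. 1 - c * (x \<bullet> x)) has_derivative (\<lambda>h. - 2 * (x \<bullet> h) * c)) (at x)" for c
    by (auto intro!: derivative_eq_intros simp: inner_commute algebra_simps)
  from this[of "inverse (R\<^sup>2)"]
  have "((\<lambda>x. 1 - (x \<bullet> x) / R\<^sup>2) has_derivative (\<lambda>h. - 2 * (x \<bullet> h) / R\<^sup>2)) (at x)"
    by (simp add: divide_inverse mult.commute)
  from has_derivative_compose[OF this DERIV_max_0_power2[unfolded has_field_derivative_def]]
  have "(cutoff R has_derivative (\<lambda>h. 2 * max 0 (1 - (x \<bullet> x) / R\<^sup>2) * (- 2 * (x \<bullet> h) / R\<^sup>2))) (at x)"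
    by (simp add: cutoff_def[abs_def])
  then show ?thesis by (rule has_derivative_eq_rhs) (simp add: grad_cutoff_def fun_eq_iff)
qed

lemma continuous_on_grad_cutoff: "continuous_on UNIV (grad_cutoff R)"
  unfolding grad_cutoff_def[abs_def] divide_inverse
  by (intro continuous_on_scaleR continuous_on_mult continuous_on_max continuous_on_diff
      continuous_on_inner continuous_on_const continuous_on_id)

lemma cutoff_bounds: "0 \<le> cutoff R x" "cutoff R x \<le> 1"
  by (auto simp: cutoff_def intro!: power_le_one)

lemma cutoff_outside:
  assumes "R > 0" "norm x \<ge> R"
  shows "cutoff R x = 0" "grad_cutoff R x = 0"
proof -
  have "R\<^sup>2 \<le> x \<bullet> x" using assms by (simp add: dot_square_norm power_mono)
  then have "1 - (x \<bullet> x) / R\<^sup>2 \<le> 0" using assms by (simp add: field_simps)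
  then show "cutoff R x = 0" "grad_cutoff R x = 0" by (simp_all add: cutoff_def grad_cutoff_def max_absorb1)
qed

lemma norm_grad_cutoff_le:
  assumes "R > 0" shows "norm (grad_cutoff R x) \<le> 4 / R"
proof (cases "norm x \<ge> R")
  case True then show ?thesis using cutoff_outside[OF assms True] assms by simp
next
  case False
  have "norm (grad_cutoff R x) = 4 * max 0 (1 - (x \<bullet> x) / R\<^sup>2) / R\<^sup>2 * norm x"
    by (simp add: grad_cutoff_def abs_mult)
  also have "\<dots> \<le> 4 * 1 / R\<^sup>2 * R"
    using False assms by (intro mult_mono divide_right_mono) auto
  also have "\<dots> = 4 / R" using assms by (simp add: power2_eq_square)
  finally show ?thesis .
qed

lemma cutoff_tendsto: "(\<lambda>n. cutoff (real (Suc n)) x) \<longlonglongrightarrow> 1"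
proof -
  have "(\<lambda>n. inverse (real (Suc n))) \<longlonglongrightarrow> 0" by (rule LIMSEQ_inverse_real_of_nat)
  then have "(\<lambda>n. (max 0 (1 - (x \<bullet> x) * (inverse (real (Suc n)))\<^sup>2))\<^sup>2) \<longlonglongrightarrow> (max 0 (1 - (x \<bullet> x) * 0\<^sup>2))\<^sup>2"
    by (intro tendsto_intros)
  then show ?thesis by (simp add: cutoff_def divide_inverse power_inverse)
qed

lemma grad_cutoff_tendsto: "(\<lambda>n. grad_cutoff (real (Suc n)) x) \<longlonglongrightarrow> 0"
proof (rule Lim_null_comparison)
  show "eventually (\<lambda>n. norm (grad_cutoff (real (Suc n)) x) \<le> 4 * inverse (real (Suc n))) sequentially"
    using norm_grad_cutoff_le[of "real (Suc _)" x] by (auto simp: divide_inverse intro!: always_eventually)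
  show "(\<lambda>n. 4 * inverse (real (Suc n))) \<longlonglongrightarrow> 0"
    using tendsto_mult_right_zero[OF LIMSEQ_inverse_real_of_nat, of 4] by simp
qed

section \<open>From bounded data to general functions\<close>

context power_convex_potential
begin

text \<open>The entropy bound is applied to \<open>G = ln (u\<^sup>2 + \<epsilon>\<^sup>2)\<close>.
  The shift keeps G bounded where u vanishes, and its gradient inherits the compact support of u,
  hence boundedness and uniform continuity.\<close>

lemma defective_log_sobolev_compact_support:
  fixes u :: "'a \<Rightarrow> real" and Du :: "'a \<Rightarrow> 'a"
  assumes Du: "\<And>x. (u has_derivative (\<lambda>h. Du x \<bullet> h)) (at x)" and cont: "continuous_on UNIV Du"
    and supp: "\<And>x. R < norm x \<Longrightarrow> u x = 0" "\<And>x. R < norm x \<Longrightarrow> Du x = 0" and \<epsilon>: "\<epsilon> > 0"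
  defines "F \<equiv> \<lambda>x. (u x)\<^sup>2 + \<epsilon>\<^sup>2"
  defines "m \<equiv> (\<integral>x. F x \<partial>gibbs U)"
  shows "(\<integral>x. F x * ln (F x) \<partial>gibbs U) - m * ln m
     \<le> 4 / \<kappa> * (\<integral>x. (norm (Du x))\<^sup>2 \<partial>gibbs U) + 1 / 2 * m"
    and "integrable (gibbs U) (\<lambda>x. F x * ln (F x))"
proof -
  have \<kappa>: "\<kappa> > 0" by (rule kappa_pos)
  have F_pos: "F x > 0" for x using \<epsilon> by (simp add: F_def add_nonneg_pos)
  have cu: "continuous_on UNIV u"
    using Du by (intro continuous_at_imp_continuous_on) (auto intro: has_derivative_continuous)
  have cF: "continuous_on UNIV F" unfolding F_def by (intro continuous_intros cu)
  have [measurable]: "u \<in> borel_measurable borel" "Du \<in> borel_measurable borel" "F \<in> borel_measurable borel"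
    using cu cont cF by (auto intro: borel_measurable_continuous_onI)
  define G where "G x = ln (F x)" for x
  define DG where "DG x = (2 * u x / F x) *\<^sub>R Du x" for x
  have expG: "exp (G x) = F x" for x using F_pos by (simp add: G_def)
  obtain C where C: "C \<ge> 0" "\<And>x. norm (u x) \<le> C" using compact_support_bounded[OF cu supp(1)] by metis
  obtain D where D: "D \<ge> 0" "\<And>x. norm (Du x) \<le> D" using compact_support_bounded[OF cont supp(2)] by metis
  have F_le: "F x \<le> C\<^sup>2 + \<epsilon>\<^sup>2" for x
    using C(2)[of x] by (simp add: F_def abs_le_square_iff[symmetric] C(1))
  have G_bd: "\<bar>G x\<bar> \<le> \<bar>ln (\<epsilon>\<^sup>2)\<bar> + \<bar>ln (C\<^sup>2 + \<epsilon>\<^sup>2)\<bar>" for x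
  proof -
    have "ln (\<epsilon>\<^sup>2) \<le> G x" unfolding G_def using \<epsilon> by (intro ln_mono) (auto simp: F_def)
    moreover have "G x \<le> ln (C\<^sup>2 + \<epsilon>\<^sup>2)" unfolding G_def using F_pos F_le by (intro ln_mono) auto
    ultimately show ?thesis by linarith
  qed
  have dG: "(G has_derivative (\<lambda>h. DG x \<bullet> h)) (at x)" for x
  proof -
    have "(F has_derivative (\<lambda>h. 2 * u x * (Du x \<bullet> h))) (at x)"
      unfolding F_def by (auto intro!: derivative_eq_intros Du)
    from has_derivative_ln[OF F_pos this] show ?thesis
      unfolding G_def[abs_def] by (rule has_derivative_eq_rhs) (simp add: DG_def fun_eq_iff divide_inverse)
  qed
  have cDG: "continuous_on UNIV DG"
    unfolding DG_def using F_pos by (intro continuous_intros cu cF cont) (auto simp: less_imp_neq[symmetric] dest: less_imp_neq)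
  have suppDG: "R < norm x \<Longrightarrow> DG x = 0" for x by (simp add: DG_def supp)
  have [measurable]: "DG \<in> borel_measurable borel" using cDG by (rule borel_measurable_continuous_onI)
  obtain M where M: "M \<ge> 0" "\<And>x. norm (DG x) \<le> M" using compact_support_bounded[OF cDG suppDG] by metis
  have "(\<integral>x. G x * exp (G x) \<partial>gibbs U) - (\<integral>x. exp (G x) \<partial>gibbs U) * ln (\<integral>x. exp (G x) \<partial>gibbs U)
    \<le> (\<integral>x. (1 / 2 + (norm (DG x))\<^sup>2 / \<kappa>) * exp (G x) \<partial>gibbs U)"
    by (rule entropy_gradient_bound[OF dG G_bd M(2) compact_support_uniformly_continuous[OF cDG suppDG]])
  then have 1: "(\<integral>x. F x * ln (F x) \<partial>gibbs U) - m * ln m \<le> (\<integral>x. (1 / 2 + (norm (DG x))\<^sup>2 / \<kappa>) * F x \<partial>gibbs U)"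
    unfolding expG m_def by (simp add: G_def mult.commute)
  \<comment> \<open>The factor 4 is the square of the 2 in the derivative of
    \<open>u\<^sup>2\<close>; the remaining quotient \<open>(u x)\<^sup>2 / F x\<close> is at most
    1.\<close>
  have key: "(1 / 2 + (norm (DG x))\<^sup>2 / \<kappa>) * F x \<le> 4 / \<kappa> * (norm (Du x))\<^sup>2 + 1 / 2 * F x" for x
  proof -
    have "(norm (DG x))\<^sup>2 * F x = 4 * (norm (Du x))\<^sup>2 * ((u x)\<^sup>2 / F x)"
      using F_pos[of x] by (simp add: DG_def power_mult_distrib power_divide power2_eq_square[of "F x"])
    also have "\<dots> \<le> 4 * (norm (Du x))\<^sup>2 * 1"
      using F_pos[of x] by (intro mult_left_mono) (auto simp: F_def)
    finally have "(norm (DG x))\<^sup>2 * F x / \<kappa> \<le> 4 * (norm (Du x))\<^sup>2 * 1 / \<kappa>"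
      using \<kappa> by (intro divide_right_mono) auto
    then show ?thesis by (simp add: algebra_simps)
  qed
  have int_F: "integrable (gibbs U) F"
    by (rule gibbs.integrable_bounded[where B="C\<^sup>2 + \<epsilon>\<^sup>2"]) (use F_pos F_le in \<open>auto simp: less_imp_le\<close>)
  have int_Du: "integrable (gibbs U) (\<lambda>x. (norm (Du x))\<^sup>2)"
    by (rule gibbs.integrable_bounded[where B="D\<^sup>2"]) (use D in \<open>auto intro!: power_mono\<close>)
  have int_L: "integrable (gibbs U) (\<lambda>x. (1 / 2 + (norm (DG x))\<^sup>2 / \<kappa>) * F x)"
  proof (rule Bochner_Integration.integrable_bound)
    show "integrable (gibbs U) (\<lambda>x. 4 / \<kappa> * (norm (Du x))\<^sup>2 + 1 / 2 * F x)" using int_F int_Du by simp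
    have "\<bar>(1 / 2 + (norm (DG x))\<^sup>2 / \<kappa>) * F x\<bar> \<le> \<bar>4 / \<kappa> * (norm (Du x))\<^sup>2 + 1 / 2 * F x\<bar>" for x
    proof -
      have "0 \<le> (1 / 2 + (norm (DG x))\<^sup>2 / \<kappa>) * F x" using F_pos[of x] \<kappa> by (intro mult_nonneg_nonneg) auto
      then show ?thesis using key[of x] by linarith
    qed
    then show "AE x in gibbs U. norm ((1 / 2 + (norm (DG x))\<^sup>2 / \<kappa>) * F x) \<le> norm (4 / \<kappa> * (norm (Du x))\<^sup>2 + 1 / 2 * F x)"
      by simp
  qed measurable
  have "(\<integral>x. (1 / 2 + (norm (DG x))\<^sup>2 / \<kappa>) * F x \<partial>gibbs U) \<le> (\<integral>x. 4 / \<kappa> * (norm (Du x))\<^sup>2 + 1 / 2 * F x \<partial>gibbs U)"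
    using int_L int_F int_Du key by (intro integral_mono) auto
  also have "\<dots> = 4 / \<kappa> * (\<integral>x. (norm (Du x))\<^sup>2 \<partial>gibbs U) + 1 / 2 * m"
    using int_F int_Du by (simp add: m_def)
  finally show "(\<integral>x. F x * ln (F x) \<partial>gibbs U) - m * ln m
     \<le> 4 / \<kappa> * (\<integral>x. (norm (Du x))\<^sup>2 \<partial>gibbs U) + 1 / 2 * m" using 1 by linarith
  show "integrable (gibbs U) (\<lambda>x. F x * ln (F x))"
  proof (rule gibbs.integrable_bounded)
    show "\<bar>F x * ln (F x)\<bar> \<le> (C\<^sup>2 + \<epsilon>\<^sup>2) * (\<bar>ln (\<epsilon>\<^sup>2)\<bar> + \<bar>ln (C\<^sup>2 + \<epsilon>\<^sup>2)\<bar>)" for x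
      unfolding abs_mult using F_pos[of x] F_le[of x] G_bd[of x] by (intro mult_mono) (auto simp: G_def)
  qed measurable
qed

lemma defective_log_sobolev:
  fixes f :: "'a \<Rightarrow> real" and Df :: "'a \<Rightarrow> 'a"
  assumes Df: "\<And>x. (f has_derivative (\<lambda>h. Df x \<bullet> h)) (at x)" and cont: "continuous_on UNIV Df"
    and int_f: "integrable (gibbs U) (\<lambda>x. (f x)\<^sup>2)"
    and int_Df: "integrable (gibbs U) (\<lambda>x. (norm (Df x))\<^sup>2)"
  shows "integrable (gibbs U) (\<lambda>x. (f x)\<^sup>2 * ln ((f x)\<^sup>2))"
    and "(\<integral>x. (f x)\<^sup>2 * ln ((f x)\<^sup>2) \<partial>gibbs U) - (\<integral>x. (f x)\<^sup>2 \<partial>gibbs U) * ln (\<integral>x. (f x)\<^sup>2 \<partial>gibbs U)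
     \<le> 4 / \<kappa> * (\<integral>x. (norm (Df x))\<^sup>2 \<partial>gibbs U) + 1 / 2 * (\<integral>x. (f x)\<^sup>2 \<partial>gibbs U)"
proof -
  have cf: "continuous_on UNIV f"
    using Df by (intro continuous_at_imp_continuous_on) (auto intro: has_derivative_continuous)
  have [measurable]: "f \<in> borel_measurable borel" "Df \<in> borel_measurable borel"
    using cf cont by (auto intro: borel_measurable_continuous_onI)
  define R where "R n = real (Suc n)" for n
  have R: "R n > 0" "1 \<le> R n" for n by (auto simp: R_def)
  define u where "u n x = cutoff (R n) x * f x" for n x
  define Du where "Du n x = cutoff (R n) x *\<^sub>R Df x + f x *\<^sub>R grad_cutoff (R n) x" for n x
  \<comment> \<open>The regularisation \<epsilon> is the inverse of the cutoff radius, so a single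
    limit removes both.\<close>
  define F where "F n x = (u n x)\<^sup>2 + (inverse (R n))\<^sup>2" for n x
  define m where "m n = (\<integral>x. F n x \<partial>gibbs U)" for n
  have ccut: "continuous_on UNIV (cutoff r :: 'a \<Rightarrow> real)" for r
    using has_derivative_cutoff by (intro continuous_at_imp_continuous_on) (blast intro: has_derivative_continuous)
  have Du: "(u n has_derivative (\<lambda>h. Du n x \<bullet> h)) (at x)" for n x
    unfolding u_def
    by (rule has_derivative_eq_rhs[OF has_derivative_mult[OF has_derivative_cutoff Df]])
       (simp add: Du_def fun_eq_iff inner_add_left)
  have cDu: "continuous_on UNIV (Du n)" for n
    unfolding Du_def by (intro continuous_intros ccut cont cf continuous_on_grad_cutoff)
  have cu: "continuous_on UNIV (u n)" for n
    unfolding u_def by (intro continuous_intros ccut cf)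
  have [measurable]: "u n \<in> borel_measurable borel" "Du n \<in> borel_measurable borel" for n
    using cu cDu by (auto intro: borel_measurable_continuous_onI)
  have [measurable]: "F n \<in> borel_measurable borel" for n unfolding F_def by measurable
  have comp: "(\<integral>x. F n x * ln (F n x) \<partial>gibbs U) - m n * ln (m n)
     \<le> 4 / \<kappa> * (\<integral>x. (norm (Du n x))\<^sup>2 \<partial>gibbs U) + 1 / 2 * m n"
    "integrable (gibbs U) (\<lambda>x. F n x * ln (F n x))" for n
  proof -
    have s: "R n < norm x \<Longrightarrow> u n x = 0" "R n < norm x \<Longrightarrow> Du n x = 0" for x
      using cutoff_outside[OF R(1)[of n], of x] by (auto simp: u_def Du_def)
    have i: "inverse (R n) > 0" using R(1)[of n] by simp
    from defective_log_sobolev_compact_support[OF Du cDu s i]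
    show "(\<integral>x. F n x * ln (F n x) \<partial>gibbs U) - m n * ln (m n)
     \<le> 4 / \<kappa> * (\<integral>x. (norm (Du n x))\<^sup>2 \<partial>gibbs U) + 1 / 2 * m n"
    "integrable (gibbs U) (\<lambda>x. F n x * ln (F n x))" unfolding F_def m_def by auto
  qed
  have lim_R: "(\<lambda>n. inverse (R n)) \<longlonglongrightarrow> 0" unfolding R_def by (rule LIMSEQ_inverse_real_of_nat)
  have lim_cut: "(\<lambda>n. cutoff (R n) x) \<longlonglongrightarrow> 1" "(\<lambda>n. grad_cutoff (R n) x) \<longlonglongrightarrow> 0" for x :: 'a
    unfolding R_def by (rule cutoff_tendsto grad_cutoff_tendsto)+
  have lim_F: "(\<lambda>n. F n x) \<longlonglongrightarrow> (f x)\<^sup>2" for x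
  proof -
    have "(\<lambda>n. F n x) \<longlonglongrightarrow> (1 * f x)\<^sup>2 + 0\<^sup>2"
      unfolding F_def u_def by (intro tendsto_add tendsto_power tendsto_mult tendsto_const lim_R lim_cut)
    then show ?thesis by simp
  qed
  have lim_Du: "(\<lambda>n. Du n x) \<longlonglongrightarrow> Df x" for x
  proof -
    have "(\<lambda>n. Du n x) \<longlonglongrightarrow> 1 *\<^sub>R Df x + f x *\<^sub>R 0"
      unfolding Du_def by (intro tendsto_add tendsto_scaleR tendsto_const lim_cut)
    then show ?thesis by simp
  qed
  have F_nonneg: "0 \<le> F n x" for n x by (simp add: F_def)
  have F_le: "F n x \<le> (f x)\<^sup>2 + 1" for n x
  proof -
    have "\<bar>u n x\<bar> \<le> 1 * \<bar>f x\<bar>" unfolding u_def abs_mult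
      using cutoff_bounds[of "R n" x] by (intro mult_right_mono) auto
    then have "(u n x)\<^sup>2 \<le> (f x)\<^sup>2" by (simp add: abs_le_square_iff)
    moreover have "(inverse (R n))\<^sup>2 \<le> 1" using R[of n] by (intro power_le_one) (auto simp: inverse_le_1_iff)
    ultimately show ?thesis by (simp add: F_def)
  qed
  \<comment> \<open>The cutoff gradient has norm at most \<open>4 / R n\<close>, hence at most 4;
    squaring the sum gives 2 and \<open>2 * 4\<^sup>2 = 32\<close>. Only an integrable majorant
    independent of n is required.\<close>
  have Du_le: "(norm (Du n x))\<^sup>2 \<le> 2 * (norm (Df x))\<^sup>2 + 32 * (f x)\<^sup>2" for n x
  proof -
    have "norm (Du n x) \<le> norm (cutoff (R n) x *\<^sub>R Df x) + norm (f x *\<^sub>R grad_cutoff (R n) x)"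
      unfolding Du_def by (rule norm_triangle_ineq)
    also have "\<dots> \<le> 1 * norm (Df x) + \<bar>f x\<bar> * 4"
    proof -
      have "norm (grad_cutoff (R n) x) \<le> 4"
      proof -
        have "4 / R n \<le> 4 / 1" using R[of n] by (intro divide_left_mono) auto
        then show ?thesis using norm_grad_cutoff_le[OF R(1)[of n], of x] by simp
      qed
      then show ?thesis using cutoff_bounds[of "R n" x] by (auto intro!: add_mono mult_mono mult_left_le_one_le)
    qed
    finally have "(norm (Du n x))\<^sup>2 \<le> (norm (Df x) + 4 * \<bar>f x\<bar>)\<^sup>2" by (intro power_mono) auto
    also have "\<dots> \<le> 2 * (norm (Df x))\<^sup>2 + 32 * (f x)\<^sup>2"
      using zero_le_power2[of "norm (Df x) - 4 * \<bar>f x\<bar>"] by (simp add: power2_eq_square algebra_simps)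
    finally show ?thesis .
  qed
  have lim_m: "m \<longlonglongrightarrow> (\<integral>x. (f x)\<^sup>2 \<partial>gibbs U)"
    unfolding m_def
  proof (rule integral_dominated_convergence[where w="\<lambda>x. (f x)\<^sup>2 + 1"])
    show "integrable (gibbs U) (\<lambda>x. (f x)\<^sup>2 + 1)" using int_f by simp
  qed (use lim_F F_le F_nonneg in auto)
  have lim_D: "(\<lambda>n. \<integral>x. (norm (Du n x))\<^sup>2 \<partial>gibbs U) \<longlonglongrightarrow> (\<integral>x. (norm (Df x))\<^sup>2 \<partial>gibbs U)"
  proof (rule integral_dominated_convergence[where w="\<lambda>x. 2 * (norm (Df x))\<^sup>2 + 32 * (f x)\<^sup>2"])
    show "integrable (gibbs U) (\<lambda>x. 2 * (norm (Df x))\<^sup>2 + 32 * (f x)\<^sup>2)" using int_f int_Df by simp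
    show "AE x in gibbs U. (\<lambda>n. (norm (Du n x))\<^sup>2) \<longlonglongrightarrow> (norm (Df x))\<^sup>2"
      using lim_Du by (auto intro!: tendsto_intros)
  qed (use Du_le in auto)
  have m_nonneg: "0 \<le> m n" for n unfolding m_def using F_nonneg by simp
  \<comment> \<open>The second moments and energies converge by domination, the entropy integral
    only by Fatou. The final 1 compensates the shift that makes its integrand nonnegative.\<close>
  let ?C = "(\<integral>x. (f x)\<^sup>2 \<partial>gibbs U) * ln (\<integral>x. (f x)\<^sup>2 \<partial>gibbs U)
       + (4 / \<kappa> * (\<integral>x. (norm (Df x))\<^sup>2 \<partial>gibbs U) + 1 / 2 * (\<integral>x. (f x)\<^sup>2 \<partial>gibbs U)) + 1"
  have lim_c: "(\<lambda>n. m n * ln (m n) + (4 / \<kappa> * (\<integral>x. (norm (Du n x))\<^sup>2 \<partial>gibbs U) + 1 / 2 * m n) + 1) \<longlonglongrightarrow> ?C"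
    by (intro tendsto_intros tendsto_mult_ln_self lim_m lim_D m_nonneg)
  have int_X: "integrable (gibbs U) (\<lambda>x. F n x * ln (F n x) + 1)" for n using comp(2) by simp
  have X_nonneg: "0 \<le> F n x * ln (F n x) + 1" for n x using mult_ln_ge[OF F_nonneg[of n x]] by simp
  have lim_X: "(\<lambda>n. F n x * ln (F n x) + 1) \<longlonglongrightarrow> (f x)\<^sup>2 * ln ((f x)\<^sup>2) + 1" for x
    by (intro tendsto_intros tendsto_mult_ln_self lim_F F_nonneg)
  have le_X: "(\<integral>x. F n x * ln (F n x) + 1 \<partial>gibbs U)
      \<le> m n * ln (m n) + (4 / \<kappa> * (\<integral>x. (norm (Du n x))\<^sup>2 \<partial>gibbs U) + 1 / 2 * m n) + 1" for n
    using comp[of n] gibbs.prob_space by simp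
  have int1: "integrable (gibbs U) (\<lambda>x. (f x)\<^sup>2 * ln ((f x)\<^sup>2) + 1)"
    by (rule Fatou_integrable(1)[OF int_X X_nonneg lim_X le_X lim_c])
  then have "integrable (gibbs U) (\<lambda>x. ((f x)\<^sup>2 * ln ((f x)\<^sup>2) + 1) - 1)"
    by (intro Bochner_Integration.integrable_diff) auto
  then show int: "integrable (gibbs U) (\<lambda>x. (f x)\<^sup>2 * ln ((f x)\<^sup>2))" by simp
  have "(\<integral>x. (f x)\<^sup>2 * ln ((f x)\<^sup>2) + 1 \<partial>gibbs U) \<le> ?C"
    by (rule Fatou_integrable(2)[OF int_X X_nonneg lim_X le_X lim_c])
  then show "(\<integral>x. (f x)\<^sup>2 * ln ((f x)\<^sup>2) \<partial>gibbs U) - (\<integral>x. (f x)\<^sup>2 \<partial>gibbs U) * ln (\<integral>x. (f x)\<^sup>2 \<partial>gibbs U)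
     \<le> 4 / \<kappa> * (\<integral>x. (norm (Df x))\<^sup>2 \<partial>gibbs U) + 1 / 2 * (\<integral>x. (f x)\<^sup>2 \<partial>gibbs U)"
    using int gibbs.prob_space by simp
qed

end

section \<open>Removing the defect\<close>

text \<open>m is the infimum of the points where the distribution function reaches 1/2: right
  continuity controls the mass above m, and the left limit the mass below it.\<close>

lemma (in prob_space) exists_median:
  fixes f :: "'a \<Rightarrow> real"
  assumes [measurable]: "f \<in> borel_measurable M"
  obtains m where "prob {x \<in> space M. m < f x} \<le> 1 / 2" "prob {x \<in> space M. f x < m} \<le> 1 / 2"
proof -
  interpret D: real_distribution "distr M borel f" by (rule real_distribution_distr) simp
  define F where "F = cdf (distr M borel f)"
  define S where "S = {t. 1 / 2 \<le> F t}"
  have mono: "F s \<le> F t" if "s \<le> t" for s t unfolding F_def using that by (rule D.cdf_nondecreasing)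
  have "eventually (\<lambda>t. 1 / 2 < F t) at_top"
    unfolding F_def by (rule order_tendstoD(1)[OF D.cdf_lim_at_top_prob]) simp
  then obtain t0 where "1 / 2 < F t0" by (auto simp: eventually_at_top_linorder)
  then have ne: "S \<noteq> {}" by (auto simp: S_def intro: less_imp_le)
  have "eventually (\<lambda>t. F t < 1 / 2) at_bot"
    unfolding F_def by (rule order_tendstoD(2)[OF D.cdf_lim_at_bot]) simp
  then obtain b where b: "F b < 1 / 2" by (auto simp: eventually_at_bot_linorder)
  have "b \<le> t" if "t \<in> S" for t
    using that b mono[of t b] by (cases "t \<le> b") (auto simp: S_def)
  then have bdd: "bdd_below S" by (rule bdd_belowI)
  define m where "m = Inf S"
  have "1 / 2 \<le> F m"
  proof (rule tendsto_lowerbound)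
    show "(F \<longlongrightarrow> F m) (at_right m)"
      unfolding F_def using D.cdf_is_right_cont[of m] by (simp add: continuous_within)
    have "1 / 2 \<le> F t" if t: "m < t" for t
    proof -
      obtain s where "s \<in> S" "s < t" using t cInf_less_iff[OF ne bdd, of t] unfolding m_def by auto
      then show ?thesis using mono[of s t] by (auto simp: S_def)
    qed
    then show "eventually (\<lambda>t. 1 / 2 \<le> F t) (at_right m)"
      by (auto simp: eventually_at_right_field intro: exI[of _ "m + 1"])
  qed simp
  moreover have "F m = prob {x \<in> space M. f x \<le> m}"
    unfolding F_def cdf_def by (subst measure_distr) (auto intro!: arg_cong[where f=prob])
  moreover have "prob {x \<in> space M. m < f x} = 1 - prob {x \<in> space M. f x \<le> m}"
    by (subst prob_compl[symmetric]) (auto intro!: arg_cong[where f=prob])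
  ultimately have 1: "prob {x \<in> space M. m < f x} \<le> 1 / 2" by linarith
  have "measure (distr M borel f) {..<m} \<le> 1 / 2"
  proof (rule tendsto_upperbound)
    show "(F \<longlongrightarrow> measure (distr M borel f) {..<m}) (at_left m)"
      unfolding F_def by (rule D.cdf_at_left)
    have "F t \<le> 1 / 2" if "t < m" for t
      using that bdd cInf_lower[of t S] unfolding m_def S_def by force
    then show "eventually (\<lambda>t. F t \<le> 1 / 2) (at_left m)"
      by (auto simp: eventually_at_left_field intro: exI[of _ "m - 1"])
  qed simp
  moreover have "measure (distr M borel f) {..<m} = prob {x \<in> space M. f x < m}"
    by (subst measure_distr) (auto intro!: arg_cong[where f=prob])
  ultimately show ?thesis using 1 by (intro that[of m]) auto
qed

section \<open>Rothaus' inequality\<close>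

lemma ln_one_plus_square_le: "ln (1 + x\<^sup>2) \<le> 2 * \<bar>x\<bar>" for x :: real
proof -
  have "ln (1 + x\<^sup>2) \<le> ln ((1 + \<bar>x\<bar>)\<^sup>2)"
    by (intro ln_mono) (auto simp: power2_eq_square algebra_simps add_pos_nonneg)
  also have "\<dots> = 2 * ln (1 + \<bar>x\<bar>)" by (subst ln_realpow) auto
  also have "\<dots> \<le> 2 * \<bar>x\<bar>" using ln_add_one_self_le_self[of "\<bar>x\<bar>"] by simp
  finally show ?thesis .
qed

text \<open>Pointwise form of Rothaus' inequality: integrated against a probability measure for which \<open>h\<close> has
  mean zero and variance \<open>\<sigma>\<^sup>2\<close>, the term \<open>2 m h\<close> disappears.\<close>
lemma rothaus_pointwise:
  fixes m h \<sigma> :: real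
  assumes m: "m \<noteq> 0" and \<sigma>: "\<sigma> > 0"
  shows "(m + h)\<^sup>2 * ln ((m + h)\<^sup>2) \<le> (m + h)\<^sup>2 * ln (m\<^sup>2 + \<sigma>\<^sup>2) + h\<^sup>2 * ln (h\<^sup>2) - h\<^sup>2 * ln (\<sigma>\<^sup>2)
           + 2 * m * h + 8 * h\<^sup>2 + 2 * \<sigma>\<^sup>2"
proof -
  define N Q where "N = m\<^sup>2 + \<sigma>\<^sup>2" and "Q = m\<^sup>2 + h\<^sup>2"
  have pos: "m\<^sup>2 > 0" "\<sigma>\<^sup>2 > 0" "N > 0" "Q > 0"
    using m \<sigma> by (auto simp: N_def Q_def intro: add_pos_nonneg add_pos_pos)
  have f2: "(m + h)\<^sup>2 = Q + 2 * m * h" by (simp add: Q_def power2_sum)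
  \<comment> \<open>First comparison, of \<open>(m + h)\<^sup>2\<close> with Q, which omits the
    cross term. By \<open>ln z \<le> z - 1\<close> the error is the mean-zero term
    \<open>2 * m * h\<close> plus a multiple of \<open>h\<^sup>2\<close>.\<close>
  have a: "(m + h)\<^sup>2 * ln ((m + h)\<^sup>2) \<le> (m + h)\<^sup>2 * ln Q + 2 * m * h + 4 * h\<^sup>2"
  proof -
    have "(m + h)\<^sup>2 * ln ((m + h)\<^sup>2) \<le> (m + h)\<^sup>2 * ln Q + (m + h)\<^sup>2 * ((m + h)\<^sup>2 / Q - 1)"
    proof (cases "m + h = 0")
      case False
      then have p: "(m + h)\<^sup>2 > 0" by simp
      have "ln ((m + h)\<^sup>2 / Q) \<le> (m + h)\<^sup>2 / Q - 1" using p pos by (intro ln_le_minus_one) simp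
      then have "(m + h)\<^sup>2 * (ln ((m + h)\<^sup>2) - ln Q) \<le> (m + h)\<^sup>2 * ((m + h)\<^sup>2 / Q - 1)"
        using p pos by (intro mult_left_mono) (auto simp: ln_div)
      then show ?thesis by (simp add: algebra_simps)
    qed simp
    also have "(m + h)\<^sup>2 * ((m + h)\<^sup>2 / Q - 1) = 2 * m * h + 4 * h\<^sup>2 * (m\<^sup>2 / Q)"
      unfolding f2 using pos by (simp add: field_simps power2_eq_square)
    also have "\<dots> \<le> 2 * m * h + 4 * h\<^sup>2 * 1"
      using pos by (intro add_left_mono mult_left_mono) (auto simp: Q_def)
    finally show ?thesis by simp
  qed
  \<comment> \<open>The log-sum inequality for the pairs \<open>(m\<^sup>2, h\<^sup>2)\<close> and
    \<open>(m\<^sup>2, \<sigma>\<^sup>2)\<close> with totals Q and N; the first entries agree and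
    contribute nothing.\<close>
  have c: "Q * (ln Q - ln N) \<le> h\<^sup>2 * (ln (h\<^sup>2) - ln (\<sigma>\<^sup>2))"
  proof -
    have lnQN: "ln Q - ln N \<le> Q / N - 1"
      using pos ln_le_minus_one[of "Q / N"] by (simp add: ln_div)
    have 1: "m\<^sup>2 * (ln Q - ln N) \<le> m\<^sup>2 * (Q / N - 1)" using lnQN by (intro mult_left_mono) auto
    have 2: "h\<^sup>2 * (ln Q - ln N - (ln (h\<^sup>2) - ln (\<sigma>\<^sup>2))) \<le> \<sigma>\<^sup>2 * (Q / N) - h\<^sup>2"
    proof (cases "h = 0")
      case False
      then have h: "h\<^sup>2 > 0" by simp
      have "ln Q - ln N - (ln (h\<^sup>2) - ln (\<sigma>\<^sup>2)) = ln ((Q / N) * (\<sigma>\<^sup>2 / h\<^sup>2))"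
        using pos h by (simp add: ln_mult ln_div)
      also have "\<dots> \<le> (Q / N) * (\<sigma>\<^sup>2 / h\<^sup>2) - 1" using pos h by (intro ln_le_minus_one) simp
      finally have "h\<^sup>2 * (ln Q - ln N - (ln (h\<^sup>2) - ln (\<sigma>\<^sup>2))) \<le> h\<^sup>2 * ((Q / N) * (\<sigma>\<^sup>2 / h\<^sup>2) - 1)"
        by (intro mult_left_mono) auto
      also have "\<dots> = \<sigma>\<^sup>2 * (Q / N) - h\<^sup>2" using h by (simp add: right_diff_distrib)
      finally show ?thesis .
    qed (use pos in simp)
    have "m\<^sup>2 * (w - 1) + (\<sigma>\<^sup>2 * w - h\<^sup>2) = N * w - Q" for w
      by (simp add: N_def Q_def algebra_simps)
    then have "m\<^sup>2 * (Q / N - 1) + (\<sigma>\<^sup>2 * (Q / N) - h\<^sup>2) = N * (Q / N) - Q" .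
    also have "\<dots> = 0" using pos by simp
    finally have "m\<^sup>2 * (ln Q - ln N) + h\<^sup>2 * (ln Q - ln N - (ln (h\<^sup>2) - ln (\<sigma>\<^sup>2))) \<le> 0"
      using 1 2 by linarith
    moreover have "Q * (ln Q - ln N) = m\<^sup>2 * (ln Q - ln N) + h\<^sup>2 * (ln Q - ln N)"
      by (simp add: Q_def distrib_right)
    ultimately show ?thesis by (simp add: right_diff_distrib)
  qed
  \<comment> \<open>The cross term times a difference of logarithms. Both logarithms exceed
    \<open>ln (m\<^sup>2)\<close>, and \<open>m\<close> times either excess is bounded linearly in
    \<open>h\<close> or \<sigma>, so m disappears from the estimate.\<close>
  have d: "2 * m * h * (ln Q - ln N) \<le> 4 * h\<^sup>2 + 2 * \<sigma>\<^sup>2"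
  proof -
    have bound: "\<bar>m\<bar> * (ln (m\<^sup>2 + x\<^sup>2) - ln (m\<^sup>2)) \<le> 2 * \<bar>x\<bar>" for x
    proof -
      have "ln (m\<^sup>2 + x\<^sup>2) - ln (m\<^sup>2) = ln ((m\<^sup>2 + x\<^sup>2) / m\<^sup>2)"
        using pos by (subst ln_div) (auto intro: add_pos_nonneg)
      also have "(m\<^sup>2 + x\<^sup>2) / m\<^sup>2 = 1 + (x / m)\<^sup>2" using m by (simp add: add_divide_distrib power_divide)
      also have "ln \<dots> \<le> 2 * \<bar>x / m\<bar>" by (rule ln_one_plus_square_le)
      finally have "\<bar>m\<bar> * (ln (m\<^sup>2 + x\<^sup>2) - ln (m\<^sup>2)) \<le> \<bar>m\<bar> * (2 * \<bar>x / m\<bar>)" by (intro mult_left_mono) auto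
      then show ?thesis using m by (simp add: abs_mult)
    qed
    have mQN: "ln (m\<^sup>2) \<le> ln Q" "ln (m\<^sup>2) \<le> ln N" using pos by (auto simp: Q_def N_def intro!: ln_mono)
    have "\<bar>m\<bar> * \<bar>ln Q - ln N\<bar> \<le> 2 * max \<bar>h\<bar> \<sigma>"
    proof -
      have "\<bar>ln Q - ln N\<bar> \<le> max (ln Q - ln (m\<^sup>2)) (ln N - ln (m\<^sup>2))" using mQN by linarith
      then have "\<bar>m\<bar> * \<bar>ln Q - ln N\<bar> \<le> \<bar>m\<bar> * max (ln Q - ln (m\<^sup>2)) (ln N - ln (m\<^sup>2))"
        by (intro mult_left_mono) auto
      also have "\<dots> \<le> 2 * max \<bar>h\<bar> \<sigma>"
        using bound[of h] bound[of \<sigma>] \<sigma> unfolding Q_def[symmetric] N_def[symmetric]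
        by (cases "ln Q - ln (m\<^sup>2) \<le> ln N - ln (m\<^sup>2)") (auto simp: max_absorb1 max_absorb2 intro: order_trans)
      finally show ?thesis .
    qed
    then have "2 * \<bar>h\<bar> * (\<bar>m\<bar> * \<bar>ln Q - ln N\<bar>) \<le> 2 * \<bar>h\<bar> * (2 * max \<bar>h\<bar> \<sigma>)" by (intro mult_left_mono) auto
    also have "\<dots> \<le> 4 * h\<^sup>2 + 2 * \<sigma>\<^sup>2"
    proof (cases "\<bar>h\<bar> \<le> \<sigma>")
      case True
      have "0 \<le> (\<bar>h\<bar> - \<sigma>)\<^sup>2" by simp
      then have "2 * \<bar>h\<bar> * \<sigma> \<le> h\<^sup>2 + \<sigma>\<^sup>2" by (simp add: power2_diff)
      moreover have "0 \<le> h\<^sup>2" by simp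
      ultimately have "2 * \<bar>h\<bar> * (2 * \<sigma>) \<le> 4 * h\<^sup>2 + 2 * \<sigma>\<^sup>2" by linarith
      then show ?thesis using True by (simp only: max_absorb2)
    next
      case False then show ?thesis by (simp add: max_absorb1 power2_eq_square)
    qed
    finally have "2 * \<bar>h\<bar> * (\<bar>m\<bar> * \<bar>ln Q - ln N\<bar>) \<le> 4 * h\<^sup>2 + 2 * \<sigma>\<^sup>2" .
    moreover have "2 * m * h * (ln Q - ln N) \<le> \<bar>2 * m * h * (ln Q - ln N)\<bar>" by simp
    moreover have "\<bar>2 * m * h * (ln Q - ln N)\<bar> = 2 * \<bar>h\<bar> * (\<bar>m\<bar> * \<bar>ln Q - ln N\<bar>)" by (simp add: abs_mult)
    ultimately show ?thesis by linarith
  qed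
  have "(m + h)\<^sup>2 * ln Q = (m + h)\<^sup>2 * ln N + Q * (ln Q - ln N) + 2 * m * h * (ln Q - ln N)"
    unfolding f2 by (simp add: algebra_simps)
  with a c d show ?thesis unfolding N_def[symmetric] by (simp add: right_diff_distrib)
qed

section \<open>Poincare and tight log-Sobolev from a defective inequality\<close>

locale defective_log_sobolev_space = prob_space M for M :: "'a::euclidean_space measure" +
  fixes A B :: real
  assumes sets_M [measurable_cong]: "sets M = sets borel"
    and A_nonneg: "0 \<le> A" and B_nonneg: "0 \<le> B" and B_less: "B < ln 2"
    and defective: "\<And>f Df. (\<And>x. (f has_derivative (\<lambda>h. Df x \<bullet> h)) (at x)) \<Longrightarrow> continuous_on UNIV Df
      \<Longrightarrow> integrable M (\<lambda>x. (f x)\<^sup>2) \<Longrightarrow> integrable M (\<lambda>x. (norm (Df x))\<^sup>2)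
      \<Longrightarrow> integrable M (\<lambda>x. (f x)\<^sup>2 * ln ((f x)\<^sup>2)) \<and>
          (\<integral>x. (f x)\<^sup>2 * ln ((f x)\<^sup>2) \<partial>M) - (\<integral>x. (f x)\<^sup>2 \<partial>M) * ln (\<integral>x. (f x)\<^sup>2 \<partial>M)
            \<le> A * (\<integral>x. (norm (Df x))\<^sup>2 \<partial>M) + B * (\<integral>x. (f x)\<^sup>2 \<partial>M)"
begin

lemma space_M: "space M = UNIV"
  using sets_eq_imp_space_eq[OF sets_M] by simp

lemma measurable_M: "measurable M N = measurable borel N"
  by (rule measurable_cong_sets[OF sets_M refl])

text \<open>The Poincare constant for functions living on at most half of the mass:
  \<open>ln 2 - B\<close> is what their entropy leaves after absorbing the defect.\<close>

definition "C = A / (ln 2 - B)"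

lemma C_nonneg: "0 \<le> C" using A_nonneg B_less by (simp add: C_def)

lemma half_support_poincare:
  assumes Df: "\<And>x. (f has_derivative (\<lambda>h. Df x \<bullet> h)) (at x)" and cont: "continuous_on UNIV Df"
    and int_f: "integrable M (\<lambda>x. (f x)\<^sup>2)" and int_Df: "integrable M (\<lambda>x. (norm (Df x))\<^sup>2)"
    and half: "prob {x. f x \<noteq> 0} \<le> 1 / 2"
  shows "(\<integral>x. (f x)\<^sup>2 \<partial>M) \<le> C * (\<integral>x. (norm (Df x))\<^sup>2 \<partial>M)"
proof -
  define c where "c = (\<integral>x. (f x)\<^sup>2 \<partial>M)"
  have c_nonneg: "0 \<le> c" by (simp add: c_def)
  have I: "0 \<le> (\<integral>x. (norm (Df x))\<^sup>2 \<partial>M)" by simp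
  show ?thesis
  proof (cases "c = 0")
    case True
    then show ?thesis using I C_nonneg unfolding c_def by simp
  next
    case False
    with c_nonneg have c: "c > 0" by simp
    have "continuous_on UNIV f"
      using Df by (intro continuous_at_imp_continuous_on) (auto intro: has_derivative_continuous)
    then have [measurable]: "f \<in> borel_measurable borel" by (rule borel_measurable_continuous_onI)
    have sets: "{x. f x \<noteq> 0} \<in> sets M" unfolding sets_M by measurable
    note D = defective[OF Df cont int_f int_Df]
    have int_ind: "integrable M (\<lambda>x. indicat_real {x. f x \<noteq> 0} x)" using sets
      by (intro integrable_real_indicator) (auto simp: less_top[symmetric])
    \<comment> \<open>Tangent line bound for the logarithm at \<open>2 * c\<close>, which is the
      mean of \<open>f\<^sup>2\<close> over its support when that has mass exactly 1/2. The
      indicator restricts the loss to the support, so its integral is at most c.\<close>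
    have point: "(f x)\<^sup>2 * (ln c + ln 2 + 1) - 2 * c * indicat_real {x. f x \<noteq> 0} x \<le> (f x)\<^sup>2 * ln ((f x)\<^sup>2)" for x
    proof (cases "f x = 0")
      case False
      then have y: "(f x)\<^sup>2 > 0" by simp
      have "ln (2 * c / (f x)\<^sup>2) \<le> 2 * c / (f x)\<^sup>2 - 1" using y c by (intro ln_le_minus_one) simp
      then have "(f x)\<^sup>2 * (ln 2 + ln c - ln ((f x)\<^sup>2)) \<le> (f x)\<^sup>2 * (2 * c / (f x)\<^sup>2 - 1)"
        using y c by (intro mult_left_mono) (auto simp: ln_div ln_mult)
      also have "\<dots> = 2 * c - (f x)\<^sup>2" using y by (simp add: right_diff_distrib)
      finally show ?thesis using False by (simp add: algebra_simps)
    qed simp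
    have "c * (ln c + ln 2 + 1) - 2 * c * prob {x. f x \<noteq> 0}
        = (\<integral>x. (f x)\<^sup>2 * (ln c + ln 2 + 1) - 2 * c * indicat_real {x. f x \<noteq> 0} x \<partial>M)"
      using int_f int_ind sets by (simp add: c_def)
    also have "\<dots> \<le> (\<integral>x. (f x)\<^sup>2 * ln ((f x)\<^sup>2) \<partial>M)"
      using D int_f int_ind point by (intro integral_mono) auto
    also have "\<dots> \<le> c * ln c + A * (\<integral>x. (norm (Df x))\<^sup>2 \<partial>M) + B * c" using D by (simp add: c_def)
    finally have "c * (ln c + ln 2 + 1) - 2 * c * prob {x. f x \<noteq> 0}
        \<le> c * ln c + A * (\<integral>x. (norm (Df x))\<^sup>2 \<partial>M) + B * c" .
    moreover have "2 * c * prob {x. f x \<noteq> 0} \<le> 2 * c * (1 / 2)" using half c by (intro mult_left_mono) auto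
    ultimately have "c * (ln 2 - B) \<le> A * (\<integral>x. (norm (Df x))\<^sup>2 \<partial>M)"
      by (simp add: algebra_simps)
    then show ?thesis using B_less unfolding C_def c_def by (simp add: field_simps)
  qed
qed

lemma positive_part_poincare:
  assumes Df: "\<And>x. (f has_derivative (\<lambda>h. Df x \<bullet> h)) (at x)" and cont: "continuous_on UNIV Df"
    and int_f: "integrable M (\<lambda>x. (f x)\<^sup>2)" and int_Df: "integrable M (\<lambda>x. (norm (Df x))\<^sup>2)"
    and half: "prob {x. 0 < f x} \<le> 1 / 2"
  shows "(\<integral>x. (max 0 (f x))\<^sup>2 \<partial>M) \<le> 2 * C * (\<integral>x. (norm (Df x))\<^sup>2 \<partial>M)"
  \<comment> \<open>The positive part is not \<open>C\<^sup>1\<close>; it is smoothed to \<open>sqrt ((max 0 f)\<^sup>2 + \<epsilon>\<^sup>2) - \<epsilon>\<close>, which has the same support.\<close>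
proof -
  have cf: "continuous_on UNIV f"
    using Df by (intro continuous_at_imp_continuous_on) (auto intro: has_derivative_continuous)
  have [measurable]: "f \<in> borel_measurable borel" "Df \<in> borel_measurable borel"
    using cf cont by (auto intro: borel_measurable_continuous_onI)
  define v where "v x = max 0 (f x)" for x
  have v: "0 \<le> v x" "(v x)\<^sup>2 \<le> (f x)\<^sup>2" for x by (auto simp: v_def max_def)
  have cv: "continuous_on UNIV v" unfolding v_def by (intro continuous_on_max continuous_on_const cf)
  have [measurable]: "v \<in> borel_measurable borel" using cv by (rule borel_measurable_continuous_onI)
  have int_v: "integrable M (\<lambda>x. (v x)\<^sup>2)"
    using v by (intro Bochner_Integration.integrable_bound[OF int_f]) (auto simp: measurable_M)
  \<comment> \<open>The factor 2 in the conclusion comes from \<open>(g + \<epsilon>)\<^sup>2 \<le>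
    2 * g\<^sup>2 + 2 * \<epsilon>\<^sup>2\<close>, which compares the positive part with its
    smoothing.\<close>
  have approx: "(\<integral>x. (v x)\<^sup>2 \<partial>M) \<le> 2 * C * (\<integral>x. (norm (Df x))\<^sup>2 \<partial>M) + 2 * \<epsilon>\<^sup>2" if \<epsilon>: "\<epsilon> > 0" for \<epsilon>
  proof -
    define q where "q x = sqrt ((v x)\<^sup>2 + \<epsilon>\<^sup>2)" for x
    define g where "g x = q x - \<epsilon>" for x
    define Dg where "Dg x = (v x / q x) *\<^sub>R Df x" for x
    have p: "(v x)\<^sup>2 + \<epsilon>\<^sup>2 > 0" for x using \<epsilon> by (simp add: add_nonneg_pos)
    have q: "q x > 0" "v x \<le> q x" "\<epsilon> \<le> q x" "q x \<le> v x + \<epsilon>" for x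
    proof -
      show "q x > 0" unfolding q_def using p by simp
      show "v x \<le> q x" "\<epsilon> \<le> q x" unfolding q_def using v \<epsilon> by (auto intro!: real_le_rsqrt)
      show "q x \<le> v x + \<epsilon>" unfolding q_def using v[of x] \<epsilon> by (intro real_le_lsqrt) (auto simp: power2_sum)
    qed
    have Dg: "(g has_derivative (\<lambda>h. Dg x \<bullet> h)) (at x)" for x
    proof -
      have "((\<lambda>x. (v x)\<^sup>2) has_derivative (\<lambda>h. 2 * v x * (Df x \<bullet> h))) (at x)"
        unfolding v_def using has_derivative_compose[OF Df DERIV_max_0_power2[unfolded has_field_derivative_def]] .
      then have "((\<lambda>x. (v x)\<^sup>2 + \<epsilon>\<^sup>2) has_derivative (\<lambda>h. 2 * v x * (Df x \<bullet> h))) (at x)"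
        by (rule has_derivative_add_const)
      from has_derivative_real_sqrt[OF p this]
      have "(q has_derivative (\<lambda>h. 2 * v x * (Df x \<bullet> h) * (inverse (q x) / 2))) (at x)"
        by (simp only: q_def[abs_def])
      from has_derivative_diff[OF this has_derivative_const[of \<epsilon>]]
      show ?thesis unfolding g_def[abs_def]
        by (rule has_derivative_eq_rhs) (simp add: Dg_def fun_eq_iff inverse_eq_divide)
    qed
    have cq: "continuous_on UNIV q" unfolding q_def by (intro continuous_intros cv)
    have cDg: "continuous_on UNIV Dg" unfolding Dg_def
      using q(1) by (intro continuous_intros cv cq cont) (auto simp: less_imp_neq[THEN not_sym])
    have [measurable]: "q \<in> borel_measurable borel" "Dg \<in> borel_measurable borel"
      using cq cDg by (auto intro: borel_measurable_continuous_onI)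
    have [measurable]: "g \<in> borel_measurable borel" unfolding g_def by measurable
    have g: "0 \<le> g x" "g x \<le> v x" "v x \<le> g x + \<epsilon>" for x using q[of x] by (auto simp: g_def)
    have g2: "(g x)\<^sup>2 \<le> (v x)\<^sup>2" for x using g by (intro power_mono) auto
    have Dg2: "(norm (Dg x))\<^sup>2 \<le> (norm (Df x))\<^sup>2" for x
    proof -
      have "v x / q x \<le> 1" using q[of x] by simp
      then have "norm (Dg x) \<le> 1 * norm (Df x)"
        unfolding Dg_def norm_scaleR using v[of x] q[of x] by (intro mult_right_mono) auto
      then show ?thesis by (intro power_mono) auto
    qed
    have int_g: "integrable M (\<lambda>x. (g x)\<^sup>2)"
      using g2 by (intro Bochner_Integration.integrable_bound[OF int_v]) (auto simp: measurable_M)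
    have int_Dg: "integrable M (\<lambda>x. (norm (Dg x))\<^sup>2)"
      using Dg2 by (intro Bochner_Integration.integrable_bound[OF int_Df]) (auto simp: measurable_M)
    have "g x \<noteq> 0 \<longleftrightarrow> 0 < f x" for x
    proof (cases "0 < f x")
      case True
      then have "\<epsilon>\<^sup>2 < (v x)\<^sup>2 + \<epsilon>\<^sup>2" by (simp add: v_def)
      then have "\<epsilon> < q x" unfolding q_def by (rule real_less_rsqrt)
      then show ?thesis using True by (simp add: g_def)
    next
      case False
      then show ?thesis using \<epsilon> by (simp add: g_def q_def v_def max_absorb1)
    qed
    then have "prob {x. g x \<noteq> 0} \<le> 1 / 2" using half by simp
    from half_support_poincare[OF Dg cDg int_g int_Dg this]
    have "(\<integral>x. (g x)\<^sup>2 \<partial>M) \<le> C * (\<integral>x. (norm (Dg x))\<^sup>2 \<partial>M)" .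
    also have "\<dots> \<le> C * (\<integral>x. (norm (Df x))\<^sup>2 \<partial>M)"
      using int_Dg int_Df Dg2 C_nonneg by (intro mult_left_mono integral_mono) auto
    finally have "2 * (\<integral>x. (g x)\<^sup>2 \<partial>M) + 2 * \<epsilon>\<^sup>2 \<le> 2 * C * (\<integral>x. (norm (Df x))\<^sup>2 \<partial>M) + 2 * \<epsilon>\<^sup>2" by simp
    moreover have "(\<integral>x. (v x)\<^sup>2 \<partial>M) \<le> (\<integral>x. 2 * (g x)\<^sup>2 + 2 * \<epsilon>\<^sup>2 \<partial>M)"
    proof (rule integral_mono)
      fix x
      have "(v x)\<^sup>2 \<le> (g x + \<epsilon>)\<^sup>2" using g[of x] v[of x] by (intro power_mono) auto
      also have "\<dots> \<le> 2 * (g x)\<^sup>2 + 2 * \<epsilon>\<^sup>2"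
        using zero_le_power2[of "g x - \<epsilon>"] by (simp add: power2_eq_square algebra_simps)
      finally show "(v x)\<^sup>2 \<le> 2 * (g x)\<^sup>2 + 2 * \<epsilon>\<^sup>2" .
    qed (use int_v int_g in auto)
    moreover have "(\<integral>x. 2 * (g x)\<^sup>2 + 2 * \<epsilon>\<^sup>2 \<partial>M) = 2 * (\<integral>x. (g x)\<^sup>2 \<partial>M) + 2 * \<epsilon>\<^sup>2"
      using int_g prob_space by simp
    ultimately show ?thesis by linarith
  qed
  have "(\<integral>x. (v x)\<^sup>2 \<partial>M) \<le> 2 * C * (\<integral>x. (norm (Df x))\<^sup>2 \<partial>M) + 2 * 0\<^sup>2"
  proof (rule tendsto_lowerbound)
    show "((\<lambda>\<epsilon>. 2 * C * (\<integral>x. (norm (Df x))\<^sup>2 \<partial>M) + 2 * \<epsilon>\<^sup>2)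
       \<longlongrightarrow> 2 * C * (\<integral>x. (norm (Df x))\<^sup>2 \<partial>M) + 2 * 0\<^sup>2) (at_right 0)"
      by (intro tendsto_intros)
    show "eventually (\<lambda>\<epsilon>. (\<integral>x. (v x)\<^sup>2 \<partial>M) \<le> 2 * C * (\<integral>x. (norm (Df x))\<^sup>2 \<partial>M) + 2 * \<epsilon>\<^sup>2) (at_right 0)"
      unfolding eventually_at_right_field using approx by (intro exI[of _ 1]) auto
  qed simp
  then show ?thesis by (simp add: v_def)
qed

text \<open>The parts of f above and below a median m each contribute \<open>2 * C\<close>, and
  their squares add up to \<open>(f x - m)\<^sup>2\<close>. Replacing m by the mean only lowers the
  second moment.\<close>

theorem poincare:
  assumes Df: "\<And>x. (f has_derivative (\<lambda>h. Df x \<bullet> h)) (at x)" and cont: "continuous_on UNIV Df"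
    and int_f: "integrable M (\<lambda>x. (f x)\<^sup>2)" and int_Df: "integrable M (\<lambda>x. (norm (Df x))\<^sup>2)"
  shows "(\<integral>x. (f x - (\<integral>y. f y \<partial>M))\<^sup>2 \<partial>M) \<le> 4 * C * (\<integral>x. (norm (Df x))\<^sup>2 \<partial>M)"
proof -
  have "continuous_on UNIV f"
    using Df by (intro continuous_at_imp_continuous_on) (auto intro: has_derivative_continuous)
  then have f_meas [measurable]: "f \<in> borel_measurable borel" by (rule borel_measurable_continuous_onI)
  have int_f1: "integrable M f"
    using square_integrable_imp_integrable[OF _ int_f] by (simp add: measurable_M)
  obtain m where m: "prob {x. m < f x} \<le> 1 / 2" "prob {x. f x < m} \<le> 1 / 2"
    using exists_median[of f] by (auto simp: space_M measurable_M)
  have int_sq: "integrable M (\<lambda>x. (f x - a)\<^sup>2)" for a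
    unfolding power2_diff using int_f int_f1 by auto
  have int_sq': "integrable M (\<lambda>x. (a - f x)\<^sup>2)" for a
    unfolding power2_diff using int_f int_f1 by auto
  have 1: "(\<integral>x. (max 0 (f x - m))\<^sup>2 \<partial>M) \<le> 2 * C * (\<integral>x. (norm (Df x))\<^sup>2 \<partial>M)"
  proof (rule positive_part_poincare)
    show "((\<lambda>x. f x - m) has_derivative (\<lambda>h. Df x \<bullet> h)) (at x)" for x
      by (auto intro!: derivative_eq_intros Df)
  qed (use cont int_sq int_Df m in auto)
  have 2: "(\<integral>x. (max 0 (m - f x))\<^sup>2 \<partial>M) \<le> 2 * C * (\<integral>x. (norm (- Df x))\<^sup>2 \<partial>M)"
  proof (rule positive_part_poincare)
    show "((\<lambda>x. m - f x) has_derivative (\<lambda>h. - Df x \<bullet> h)) (at x)" for x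
      by (auto intro!: derivative_eq_intros Df)
  qed (use cont int_sq' int_Df m in \<open>auto intro: continuous_on_minus\<close>)
  have i1: "integrable M (\<lambda>x. (max 0 (f x - m))\<^sup>2)"
    by (intro Bochner_Integration.integrable_bound[OF int_sq[of m]]) (auto simp: measurable_M max_def)
  have i2: "integrable M (\<lambda>x. (max 0 (m - f x))\<^sup>2)"
    by (intro Bochner_Integration.integrable_bound[OF int_sq[of m]]) (auto simp: measurable_M max_def power2_commute)
  define a where "a = (\<integral>y. f y \<partial>M)"
  have "(\<integral>x. (f x - m)\<^sup>2 \<partial>M) - (\<integral>x. (f x - a)\<^sup>2 \<partial>M) = (\<integral>x. (f x - m)\<^sup>2 - (f x - a)\<^sup>2 \<partial>M)"
    using int_sq by simp
  also have "\<dots> = (\<integral>x. 2 * (a - m) * f x + (m\<^sup>2 - a\<^sup>2) \<partial>M)"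
    by (intro Bochner_Integration.integral_cong) (auto simp: power2_eq_square algebra_simps)
  also have "\<dots> = 2 * (a - m) * a + (m\<^sup>2 - a\<^sup>2)" using int_f1 prob_space by (simp add: a_def)
  also have "\<dots> = (a - m)\<^sup>2" by (simp add: power2_eq_square algebra_simps)
  finally have "(\<integral>x. (f x - a)\<^sup>2 \<partial>M) \<le> (\<integral>x. (f x - m)\<^sup>2 \<partial>M)" using zero_le_power2[of "a - m"] by linarith
  also have "\<dots> = (\<integral>x. (max 0 (f x - m))\<^sup>2 + (max 0 (m - f x))\<^sup>2 \<partial>M)"
    by (intro Bochner_Integration.integral_cong) (auto simp: max_def power2_commute)
  also have "\<dots> = (\<integral>x. (max 0 (f x - m))\<^sup>2 \<partial>M) + (\<integral>x. (max 0 (m - f x))\<^sup>2 \<partial>M)"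
    using i1 i2 by simp
  finally show ?thesis using 1 2 by (simp add: a_def)
qed

text \<open>For the centred function h the defect is B times its variance, and passing back from h
  to f costs 10 times the variance. The Poincare inequality turns both into gradient terms.\<close>

theorem log_sobolev:
  assumes Df: "\<And>x. (f has_derivative (\<lambda>h. Df x \<bullet> h)) (at x)" and cont: "continuous_on UNIV Df"
    and int_f: "integrable M (\<lambda>x. (f x)\<^sup>2)" and int_Df: "integrable M (\<lambda>x. (norm (Df x))\<^sup>2)"
  shows "(\<integral>x. (f x)\<^sup>2 * ln ((f x)\<^sup>2) \<partial>M) - (\<integral>x. (f x)\<^sup>2 \<partial>M) * ln (\<integral>x. (f x)\<^sup>2 \<partial>M)
           \<le> (A + (B + 10) * (4 * C)) * (\<integral>x. (norm (Df x))\<^sup>2 \<partial>M)"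
proof -
  have "continuous_on UNIV f"
    using Df by (intro continuous_at_imp_continuous_on) (auto intro: has_derivative_continuous)
  then have f_meas [measurable]: "f \<in> borel_measurable borel" by (rule borel_measurable_continuous_onI)
  have int_f1: "integrable M f"
    using square_integrable_imp_integrable[OF _ int_f] by (simp add: measurable_M)
  define m where "m = (\<integral>y. f y \<partial>M)"
  define h where "h x = f x - m" for x
  define S where "S = (\<integral>x. (h x)\<^sup>2 \<partial>M)"
  define I where "I = (\<integral>x. (norm (Df x))\<^sup>2 \<partial>M)"
  have I: "0 \<le> I" by (simp add: I_def)
  have int_h: "integrable M h" unfolding h_def using int_f1 by auto
  have int_h2: "integrable M (\<lambda>x. (h x)\<^sup>2)" unfolding h_def power2_diff using int_f int_f1 by auto
  have Dh: "(h has_derivative (\<lambda>v. Df x \<bullet> v)) (at x)" for x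
    unfolding h_def by (auto intro!: derivative_eq_intros Df)
  note Lf = defective[OF Df cont int_f int_Df] and Lh = defective[OF Dh cont int_h2 int_Df]
  have mean_h: "(\<integral>x. h x \<partial>M) = 0" unfolding h_def using int_f1 prob_space by (simp add: m_def)
  have S_le: "S \<le> 4 * C * I" using poincare[OF Df cont int_f int_Df] by (simp add: S_def h_def m_def I_def)
  have S: "0 \<le> S" by (simp add: S_def)
  have N: "(\<integral>x. (f x)\<^sup>2 \<partial>M) = m\<^sup>2 + S"
  proof -
    have "(\<integral>x. (f x)\<^sup>2 \<partial>M) = (\<integral>x. m\<^sup>2 + 2 * m * h x + (h x)\<^sup>2 \<partial>M)"
      by (intro Bochner_Integration.integral_cong) (auto simp: h_def power2_eq_square algebra_simps)
    also have "\<dots> = m\<^sup>2 + S" using int_h int_h2 mean_h prob_space by (simp add: S_def)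
    finally show ?thesis .
  qed
  have tight: "(\<integral>x. (f x)\<^sup>2 * ln ((f x)\<^sup>2) \<partial>M) - (\<integral>x. (f x)\<^sup>2 \<partial>M) * ln (\<integral>x. (f x)\<^sup>2 \<partial>M) \<le> A * I + B * S + 10 * S"
  proof -
    \<comment> \<open>The pointwise inequality needs a nonzero mean and positive variance. With mean
      zero the defective inequality already suffices; with variance zero f is almost everywhere
      constant and has no entropy.\<close>
    consider "m = 0" | "S = 0" | "m \<noteq> 0" "S > 0" using S by linarith
    then show ?thesis
    proof cases
      case 1
      then have "h = f" by (auto simp: h_def)
      then have "S = (\<integral>x. (f x)\<^sup>2 \<partial>M)" by (simp add: S_def)
      then have "B * (\<integral>x. (f x)\<^sup>2 \<partial>M) = B * S" by simp
      then show ?thesis using conjunct2[OF Lf] S unfolding I_def by linarith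
    next
      case 2
      have "AE x in M. (h x)\<^sup>2 = 0"
        using integral_nonneg_eq_0_iff_AE[OF int_h2] 2 by (simp add: S_def)
      then have "AE x in M. f x = m" by (rule AE_mp) (auto simp: h_def)
      then have "(\<integral>x. (f x)\<^sup>2 * ln ((f x)\<^sup>2) \<partial>M) = (\<integral>x. m\<^sup>2 * ln (m\<^sup>2) \<partial>M)"
        by (intro integral_cong_AE) (auto simp: measurable_M)
      then show ?thesis unfolding N using 2 I A_nonneg prob_space by simp
    next
      case 3
      define \<sigma> where "\<sigma> = sqrt S"
      have \<sigma>: "\<sigma> > 0" "\<sigma>\<^sup>2 = S" using 3 by (auto simp: \<sigma>_def)
      have pt: "(f x)\<^sup>2 * ln ((f x)\<^sup>2) \<le> (f x)\<^sup>2 * ln (m\<^sup>2 + S) + (h x)\<^sup>2 * ln ((h x)\<^sup>2) - (h x)\<^sup>2 * ln S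
           + 2 * m * h x + 8 * (h x)\<^sup>2 + 2 * S" for x
        using rothaus_pointwise[OF 3(1) \<sigma>(1), of "h x"] unfolding \<sigma>(2) by (simp add: h_def)
      have "(\<integral>x. (f x)\<^sup>2 * ln ((f x)\<^sup>2) \<partial>M) \<le> (\<integral>x. (f x)\<^sup>2 * ln (m\<^sup>2 + S) + (h x)\<^sup>2 * ln ((h x)\<^sup>2) - (h x)\<^sup>2 * ln S
           + 2 * m * h x + 8 * (h x)\<^sup>2 + 2 * S \<partial>M)"
        using Lf Lh int_f int_h int_h2 pt by (intro integral_mono) auto
      also have "\<dots> = (m\<^sup>2 + S) * ln (m\<^sup>2 + S) + (\<integral>x. (h x)\<^sup>2 * ln ((h x)\<^sup>2) \<partial>M) - S * ln S + 10 * S"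
        using Lh int_f int_h int_h2 mean_h prob_space N by (simp add: S_def)
      finally show ?thesis unfolding N using Lh by (simp add: S_def I_def)
    qed
  qed
  have "(B + 10) * S \<le> (B + 10) * (4 * C * I)" using S_le B_nonneg by (intro mult_left_mono) auto
  with tight have "(\<integral>x. (f x)\<^sup>2 * ln ((f x)\<^sup>2) \<partial>M) - (\<integral>x. (f x)\<^sup>2 \<partial>M) * ln (\<integral>x. (f x)\<^sup>2 \<partial>M)
      \<le> A * I + (B + 10) * (4 * C * I)" by (simp add: distrib_right)
  then show ?thesis by (simp add: I_def algebra_simps)
qed

end

section \<open>Comparison of constants\<close>

text \<open>One factor 36 is split off; the remaining bases 36 and \<open>sqrt 32\<close> are both
  at least 5, and their exponents \<open>1 - 1 / \<beta>\<close> and \<open>1 / \<beta>\<close> add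
  up to 1. Hence the bound 36 * 5 = 180 for every \<beta>.\<close>

lemma (in power_convex_potential) constant_lower_bound:
  "180 / \<kappa> \<le> 36 powr ((2 * \<beta> - 1) / \<beta>) * (32 / K\<^sup>2) powr (1 / (2 * \<beta>))"
proof -
  have \<beta>: "\<beta> > 0" "1 / \<beta> \<le> 1" using beta_ge by auto
  have "180 / \<kappa> = 36 * (5 powr (1 - 1 / \<beta>) * (5 powr (1 / \<beta>) / \<kappa>))"
    by (simp flip: powr_add)
  also have "\<dots> \<le> 36 * (36 powr (1 - 1 / \<beta>) * (32 / K\<^sup>2) powr (1 / (2 * \<beta>)))"
  proof (intro mult_left_mono mult_mono)
    show "5 powr (1 - 1 / \<beta>) \<le> 36 powr (1 - 1 / \<beta>)" using \<beta> by (intro powr_mono2) auto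
    have "5 powr (1 / \<beta>) / \<kappa> = (5 / K) powr (1 / \<beta>)" using K_pos by (simp add: \<kappa>_def powr_divide)
    also have "\<dots> = ((5 / K) powr 2) powr (1 / (2 * \<beta>))" by (simp add: powr_powr)
    also have "\<dots> \<le> (32 / K\<^sup>2) powr (1 / (2 * \<beta>))"
      using K_pos \<beta> by (intro powr_mono2) (auto simp: power_divide divide_right_mono)
    finally show "5 powr (1 / \<beta>) / \<kappa> \<le> (32 / K\<^sup>2) powr (1 / (2 * \<beta>))" .
  qed (use kappa_pos in auto)
  also have "\<dots> = 36 powr (1 + (1 - 1 / \<beta>)) * (32 / K\<^sup>2) powr (1 / (2 * \<beta>))"
    by (subst powr_add) simp
  also have "1 + (1 - 1 / \<beta>) = (2 * \<beta> - 1) / \<beta>" using \<beta> by (simp add: field_simps)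
  finally show ?thesis .
qed

theorem theorem5p10:
  fixes U :: "'a::euclidean_space \<Rightarrow> real"
    and gradU :: "'a \<Rightarrow> 'a"
    and K \<beta> :: real
  assumes smooth: "smooth_fun U"
    and gradU: "\<And>x. (U has_derivative (\<lambda>h. gradU x \<bullet> h)) (at x)"
    and integrable_Z: "integrable lborel (\<lambda>x. exp (- U x))"
    and K_pos: "K > 0"
    and beta_ge: "\<beta> \<ge> 1"
    and convex: "\<And>x y. (gradU x - gradU y) \<bullet> (x - y) \<ge> K * norm (x - y) powr (2 * \<beta>)"
  shows
    "\<forall>(f :: 'a \<Rightarrow> real) (gradf :: 'a \<Rightarrow> 'a).
        (\<forall>x. (f has_derivative (\<lambda>h. gradf x \<bullet> h)) (at x)) \<and> continuous_on UNIV gradf \<and>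
        integrable (gibbs U) (\<lambda>x. (f x)\<^sup>2) \<and>
        integrable (gibbs U) (\<lambda>x. (norm (gradf x))\<^sup>2)
      \<longrightarrow>
        (\<integral>x. (f x - (\<integral>y. f y \<partial>gibbs U))\<^sup>2 \<partial>gibbs U)
          \<le> 4 * 36 powr ((2 * \<beta> - 1) / \<beta>) * (32 / K\<^sup>2) powr (1 / (2 * \<beta>))
             * (\<integral>x. (norm (gradf x))\<^sup>2 \<partial>gibbs U)
      \<and> integrable (gibbs U) (\<lambda>x. (f x)\<^sup>2 * ln ((f x)\<^sup>2))
      \<and> (\<integral>x. (f x)\<^sup>2 * ln ((f x)\<^sup>2) \<partial>gibbs U)
          - (\<integral>x. (f x)\<^sup>2 \<partial>gibbs U) * ln (\<integral>x. (f x)\<^sup>2 \<partial>gibbs U)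
          \<le> (32 / K\<^sup>2) powr (1 / (2 * \<beta>))
             * (4 powr ((3 * \<beta> - 2) / (2 * \<beta> - 1)) * 36 powr ((\<beta> - 1) / \<beta>)
                + 8 * 36 powr ((2 * \<beta> - 1) / \<beta>))
             * (\<integral>x. (norm (gradf x))\<^sup>2 \<partial>gibbs U)"
proof (intro allI impI, elim conjE)
  fix f :: "'a \<Rightarrow> real" and gradf :: "'a \<Rightarrow> 'a"
  assume Df: "\<forall>x. (f has_derivative (\<lambda>h. gradf x \<bullet> h)) (at x)" and cont: "continuous_on UNIV gradf"
    and int_f: "integrable (gibbs U) (\<lambda>x. (f x)\<^sup>2)"
    and int_Df: "integrable (gibbs U) (\<lambda>x. (norm (gradf x))\<^sup>2)"
  from Df have Df: "\<And>x. (f has_derivative (\<lambda>h. gradf x \<bullet> h)) (at x)" by blast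
  interpret P: power_convex_potential U gradU K \<beta>
    using assms by unfold_locales auto
  define k where "k = P.\<kappa>"
  have k: "k > 0" unfolding k_def by (rule P.kappa_pos)
  interpret L: defective_log_sobolev_space "gibbs U" "4 / k" "1 / 2"
  proof
    show "(1::real) / 2 < ln 2" using ln2_ge_two_thirds by linarith
  next
    fix f :: "'a \<Rightarrow> real" and Df :: "'a \<Rightarrow> 'a"
    assume "\<And>x. (f has_derivative (\<lambda>h. Df x \<bullet> h)) (at x)" "continuous_on UNIV Df"
      "integrable (gibbs U) (\<lambda>x. (f x)\<^sup>2)" "integrable (gibbs U) (\<lambda>x. (norm (Df x))\<^sup>2)"
    from P.defective_log_sobolev[OF this]
    show "integrable (gibbs U) (\<lambda>x. (f x)\<^sup>2 * ln ((f x)\<^sup>2)) \<and>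
      (\<integral>x. (f x)\<^sup>2 * ln ((f x)\<^sup>2) \<partial>gibbs U) - (\<integral>x. (f x)\<^sup>2 \<partial>gibbs U) * ln (\<integral>x. (f x)\<^sup>2 \<partial>gibbs U)
        \<le> 4 / k * (\<integral>x. (norm (Df x))\<^sup>2 \<partial>gibbs U) + 1 / 2 * (\<integral>x. (f x)\<^sup>2 \<partial>gibbs U)"
      by (simp add: k_def)
  qed (use k in auto)
  define T where "T = 36 powr ((2 * \<beta> - 1) / \<beta>) * (32 / K\<^sup>2) powr (1 / (2 * \<beta>))"
  have T: "180 / k \<le> T" unfolding T_def k_def by (rule P.constant_lower_bound)
  \<comment> \<open>From \<open>ln 2 \<ge> 2 / 3\<close> the room \<open>ln 2 - 1 / 2\<close> is at
    least 1/6. The Poincare constant \<open>4 * L.C\<close> is thus at most \<open>96 / k\<close>,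
    against the claimed \<open>4 * T\<close>, which is at least \<open>720 / k\<close>.\<close>
  have C: "L.C \<le> 24 / k"
  proof -
    have "L.C \<le> (4 / k) / (1 / 6)"
      unfolding L.C_def using k ln2_ge_two_thirds by (intro divide_left_mono) auto
    then show ?thesis by simp
  qed
  define j where "j = 1 / k"
  have j: "0 \<le> j" "180 * j \<le> T" "L.C \<le> 24 * j" "4 / k = 4 * j" using k T C by (simp_all add: j_def)
  let ?I = "\<integral>x. (norm (gradf x))\<^sup>2 \<partial>gibbs U"
  have I: "0 \<le> ?I" by simp
  have "4 * L.C * ?I \<le> 4 * T * ?I"
    using j I by (intro mult_right_mono) auto
  with L.poincare[OF Df cont int_f int_Df]
  have poincare: "(\<integral>x. (f x - (\<integral>y. f y \<partial>gibbs U))\<^sup>2 \<partial>gibbs U) \<le> 4 * T * ?I" by linarith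
  have "(4 / k + (1 / 2 + 10) * (4 * L.C)) * ?I
      \<le> ((32 / K\<^sup>2) powr (1 / (2 * \<beta>)) * (4 powr ((3 * \<beta> - 2) / (2 * \<beta> - 1)) * 36 powr ((\<beta> - 1) / \<beta>)
          + 8 * 36 powr ((2 * \<beta> - 1) / \<beta>))) * ?I"
  proof (rule mult_right_mono[OF _ I])
    \<comment> \<open>In units of \<open>1 / k\<close> the left side is at most 4 + 10.5 * 96 =
      1012, while \<open>8 * T\<close> is at least 1440. The remaining summand of the claimed
      constant is nonnegative.\<close>
    have "4 * j + (1 / 2 + 10) * (4 * c) \<le> 8 * T" if "c \<le> 24 * j" for c
      using j(1,2) that by simp
    from this[OF j(3)] have "4 / k + (1 / 2 + 10) * (4 * L.C) \<le> 8 * T" by (simp only: j(4))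
    also have "\<dots> \<le> (32 / K\<^sup>2) powr (1 / (2 * \<beta>)) * (4 powr ((3 * \<beta> - 2) / (2 * \<beta> - 1)) * 36 powr ((\<beta> - 1) / \<beta>))
        + 8 * T" by simp
    also have "\<dots> = (32 / K\<^sup>2) powr (1 / (2 * \<beta>)) * (4 powr ((3 * \<beta> - 2) / (2 * \<beta> - 1)) * 36 powr ((\<beta> - 1) / \<beta>)
          + 8 * 36 powr ((2 * \<beta> - 1) / \<beta>))" by (simp add: T_def distrib_left)
    finally show "4 / k + (1 / 2 + 10) * (4 * L.C) \<le> \<dots>" .
  qed
  with L.log_sobolev[OF Df cont int_f int_Df] poincare P.defective_log_sobolev(1)[OF Df cont int_f int_Df]
  show "(\<integral>x. (f x - (\<integral>y. f y \<partial>gibbs U))\<^sup>2 \<partial>gibbs U)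
          \<le> 4 * 36 powr ((2 * \<beta> - 1) / \<beta>) * (32 / K\<^sup>2) powr (1 / (2 * \<beta>)) * ?I
      \<and> integrable (gibbs U) (\<lambda>x. (f x)\<^sup>2 * ln ((f x)\<^sup>2))
      \<and> (\<integral>x. (f x)\<^sup>2 * ln ((f x)\<^sup>2) \<partial>gibbs U)
          - (\<integral>x. (f x)\<^sup>2 \<partial>gibbs U) * ln (\<integral>x. (f x)\<^sup>2 \<partial>gibbs U)
          \<le> (32 / K\<^sup>2) powr (1 / (2 * \<beta>))
             * (4 powr ((3 * \<beta> - 2) / (2 * \<beta> - 1)) * 36 powr ((\<beta> - 1) / \<beta>)
                + 8 * 36 powr ((2 * \<beta> - 1) / \<beta>)) * ?I"
    unfolding T_def by (auto simp: mult.assoc intro: order_trans)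
qed

end
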